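(* Let $k = k(n) < n$ be a positive-integer-valued function with $k(n)\to\infty$ and let $d = d(n) \ge 1$ be an integer-valued function with $d(n) = o(\log k(n))$ as $n \to \infty$. Then, for $k$-means (respectively, for $k$-medians), there are a universal constant $D > 0$ and sequences $\delta_n \to 0$, $K_n \to \infty$ such that for every sufficiently large $n$ there exist $m = m(n)$ and a set $X \subset \mathbb{R}^m$ with $|X| = n$ and doubling dimension at most $D$ such that, with $G : \mathbb{R}^m \to \mathbb{R}^{d}$ a random projection, each of the following holds with probability at least $2/3$ over $G$: (i) the $k$-means (resp. $k$-medians) cost of $GX$ is at most $\delta_n$ times the $k$-means (resp. $k$-medians) cost of $X$; (ii) an optimal choice of $k$ centers in $GX$, when pulled back to $X$, has $k$-means (resp. $k$-medians) cost for $X$ at least $K_n$ times the optimal $k$-means (resp. $k$-medians) cost of $X$, i.e. it is only an $\omega(1)$-approximate solution in the original space $\mathbb{R}^m$.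
   Context: All norms are Euclidean. For a finite dataset $Y$ in a Euclidean space and a set $S \subseteq Y$ of $k$ centers, the $k$-medians cost of $S$ is $\sum_{y\in Y}\min_{s\in S}\|y-s\|$ and the $k$-means cost of $S$ is $\sum_{y\in Y}\min_{s\in S}\|y-s\|^2$. The $k$-medians (resp. $k$-means) cost of $Y$ is the minimum over $S \subseteq Y$, $|S| = k$; an optimal choice of $k$ centers is a minimizer. $GX = \{Gx : x \in X\}$. A set of centers in $GX$ is pulled back to $X$ via the correspondence $Gx \leftrightarrow x$ (almost surely a bijection). Doubling dimension: for $x \in X$, $r > 0$ let $B(x,r) = \{y \in X : \|x-y\| \le r\}$. The doubling constant $\lambda_X$ is the smallest $\lambda$ such that for all $x \in X$, $r > 0$ there is $S \subseteq X$ with $|S| \le \lambda$ and $B(x,r) \subseteq \bigcup_{s \in S} B(s, r/2)$. The doubling dimension is $d_X = \log_2 \lambda_X$. A random projection from $\mathbb{R}^m$ to $\mathbb{R}^d$ is a random linear map $G$ given by a $d \times m$ matrix with i.i.d. entries drawn from $\mathcal{N}(0, 1/d)$ (variance $1/d$). *)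

theory Defs
  imports "HOL-Probability.Probability" "HOL-Library.Landau_Symbols"
begin

text \<open>
  The dimensions are quantified inside the theorem, so a vector of \<open>\<real>\<^sup>m\<close> is a function
  \<open>nat \<Rightarrow> real\<close> vanishing outside \<open>{..<m}\<close>, i.e. an element of
  \<open>topspace (Euclidean_space m)\<close>; on this set \<open>eucl_dist m\<close> is the Euclidean metric.
\<close>

definition eucl_dist :: "nat \<Rightarrow> (nat \<Rightarrow> real) \<Rightarrow> (nat \<Rightarrow> real) \<Rightarrow> real" where
  "eucl_dist m x y = L2_set (\<lambda>i. x i - y i) {..<m}"

definition kmedians_cost :: "nat \<Rightarrow> (nat \<Rightarrow> real) set \<Rightarrow> (nat \<Rightarrow> real) set \<Rightarrow> real" where
  "kmedians_cost m Y S = (\<Sum>y\<in>Y. Min ((\<lambda>s. eucl_dist m y s) ` S))"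

definition kmeans_cost :: "nat \<Rightarrow> (nat \<Rightarrow> real) set \<Rightarrow> (nat \<Rightarrow> real) set \<Rightarrow> real" where
  "kmeans_cost m Y S = (\<Sum>y\<in>Y. Min ((\<lambda>s. (eucl_dist m y s)\<^sup>2) ` S))"

text \<open>
  Below, \<open>cost\<close> is the objective on a fixed dataset \<open>Y\<close>, as a function of the set of centers.
\<close>

definition is_opt_centers ::
    "((nat \<Rightarrow> real) set \<Rightarrow> real) \<Rightarrow> nat \<Rightarrow> (nat \<Rightarrow> real) set \<Rightarrow> (nat \<Rightarrow> real) set \<Rightarrow> bool" where
  "is_opt_centers cost k Y S \<longleftrightarrow> is_arg_min cost (\<lambda>S. S \<subseteq> Y \<and> card S = k) S"

definition opt_cost :: "((nat \<Rightarrow> real) set \<Rightarrow> real) \<Rightarrow> nat \<Rightarrow> (nat \<Rightarrow> real) set \<Rightarrow> real" where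
  "opt_cost cost k Y = Min (cost ` {S. S \<subseteq> Y \<and> card S = k})"

definition doubling_constant :: "nat \<Rightarrow> (nat \<Rightarrow> real) set \<Rightarrow> nat" where
  "doubling_constant m X = (LEAST l. \<forall>x\<in>X. \<forall>r>0. \<exists>S\<subseteq>X. finite S \<and> card S \<le> l \<and>
     {y\<in>X. eucl_dist m x y \<le> r} \<subseteq> (\<Union>s\<in>S. {y\<in>X. eucl_dist m s y \<le> r / 2}))"

definition doubling_dim :: "nat \<Rightarrow> (nat \<Rightarrow> real) set \<Rightarrow> real" where
  "doubling_dim m X = log 2 (real (doubling_constant m X))"

text \<open>
  The second parameter of \<open>normal_density\<close> is the standard deviation, so the entries have
  variance \<open>1 / d\<close>.
\<close>

definition gaussian_matrix :: "nat \<Rightarrow> nat \<Rightarrow> (nat \<times> nat \<Rightarrow> real) measure" where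
  "gaussian_matrix d m =
     (\<Pi>\<^sub>M ij\<in>{..<d} \<times> {..<m}. density lborel (\<lambda>t. ennreal (normal_density 0 (sqrt (1 / real d)) t)))"

definition mat_apply ::
    "nat \<Rightarrow> nat \<Rightarrow> (nat \<times> nat \<Rightarrow> real) \<Rightarrow> (nat \<Rightarrow> real) \<Rightarrow> (nat \<Rightarrow> real)" where
  "mat_apply d m G x = (\<lambda>i. if i < d then \<Sum>j<m. G (i, j) * x j else 0)"

end

theory Submission
  imports Defs
begin

text \<open>
  The points \<open>x\<^sub>j = (\<Sum>i<j. w\<^sub>i e\<^sub>i)\<close> satisfy \<open>\<parallel>x\<^sub>a - x\<^sub>b\<parallel>\<^sup>2 = (\<Sum>i=a..<b. w\<^sub>i\<^sup>2)\<close>, so they form a square-root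
  snowflake of a subset of the line and are doubling, while the images of the orthogonal edges
  \<open>w\<^sub>i e\<^sub>i\<close> are independent. Grouping the points into \<open>k + 1\<close> clusters, an optimal solution drops the
  center of one of them, which in \<open>\<real>\<^sup>m\<close> is best done across the unique edge of length \<open>1\<close>; across
  each of the about \<open>k\<close> edges of length \<open>1 / u\<close> it costs at least \<open>1 / u\<close>. A single edge is
  contracted by a factor \<open>\<epsilon>\<close> with probability at least \<open>(\<epsilon> / 3) ^ d\<close>, so for \<open>d = o(log k)\<close> some
  expensive edge is contracted by a factor \<open>u\<^sup>4\<close> with \<open>u \<rightarrow> 0\<close>, whereas the edge of length \<open>1\<close> keeps
  length at least \<open>u\<close>. The projected optimum is then less than \<open>u\<^sup>2\<close>, and it must drop a center
  across an expensive edge.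
\<close>

section \<open>The Euclidean distance and clustering costs\<close>

lemma eucl_dist_nonneg [simp]: "0 \<le> eucl_dist m x y"
  by (simp add: eucl_dist_def)

lemma eucl_dist_commute: "eucl_dist m x y = eucl_dist m y x"
  by (simp add: eucl_dist_def L2_set_def power2_commute)

lemma eucl_dist_self [simp]: "eucl_dist m x x = 0"
  by (simp add: eucl_dist_def L2_set_def)

lemma eucl_dist_triangle: "eucl_dist m x z \<le> eucl_dist m x y + eucl_dist m y z"
  using L2_set_triangle_ineq[of "\<lambda>i. x i - y i" "\<lambda>i. y i - z i" "{..<m}"]
  by (simp add: eucl_dist_def)

lemma eucl_dist_chain:
  assumes "a \<le> b"
  shows "eucl_dist m (q a) (q b) \<le> (\<Sum>i=a..<b. eucl_dist m (q i) (q (Suc i)))"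
  using assms
proof (induction b rule: dec_induct)
  case (step b)
  then show ?case
    using eucl_dist_triangle[of m "q a" "q (Suc b)" "q b"] by simp
qed simp

text \<open>Both objectives at once: \<open>\<phi> t = t\<close> gives medians, \<open>\<phi> t = t\<^sup>2\<close> gives means.\<close>

definition gcost ::
    "(real \<Rightarrow> real) \<Rightarrow> nat \<Rightarrow> (nat \<Rightarrow> real) set \<Rightarrow> (nat \<Rightarrow> real) set \<Rightarrow> real" where
  "gcost \<phi> m Y S = (\<Sum>y\<in>Y. Min ((\<lambda>s. \<phi> (eucl_dist m y s)) ` S))"

text \<open>What \<open>t\<close> and \<open>t\<^sup>2\<close> have in common: below 1 both lie
  between \<open>t\<^sup>2\<close> and \<open>t\<close>, above 1 both dominate \<open>t\<close>.
  Bounds stated with these two envelopes serve both objectives at once.\<close>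

locale cost_profile =
  fixes \<phi> :: "real \<Rightarrow> real"
  assumes mono: "0 \<le> s \<Longrightarrow> s \<le> t \<Longrightarrow> \<phi> s \<le> \<phi> t"
    and small_le: "0 \<le> t \<Longrightarrow> t \<le> 1 \<Longrightarrow> \<phi> t \<le> t"
    and small_ge: "0 \<le> t \<Longrightarrow> t \<le> 1 \<Longrightarrow> t\<^sup>2 \<le> \<phi> t"
    and large_ge: "1 \<le> t \<Longrightarrow> t \<le> \<phi> t"
    and measurable_profile: "\<phi> \<in> borel_measurable borel"
begin

lemma nonneg: "0 \<le> t \<Longrightarrow> 0 \<le> \<phi> t"
  using mono[of 0 t] small_ge[of 0] by auto

text \<open>A single point far from every center already pays \<open>\<phi> c\<close>, the other
  summands being nonnegative. All lower bounds on costs below are of this kind.\<close>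

lemma gcost_ge:
  assumes "finite Y" "y \<in> Y" "finite S" "S \<noteq> {}" "0 \<le> c"
    and "\<And>s. s \<in> S \<Longrightarrow> c \<le> eucl_dist m y s"
  shows "\<phi> c \<le> gcost \<phi> m Y S"
proof -
  have "\<phi> c \<le> Min ((\<lambda>s. \<phi> (eucl_dist m y s)) ` S)"
    using assms by (auto intro: mono)
  also have "\<dots> \<le> gcost \<phi> m Y S"
    unfolding gcost_def using assms
    by (intro member_le_sum) (auto simp: Min_ge_iff intro: nonneg)
  finally show ?thesis .
qed

text \<open>Upper bounds on costs come from exhibiting an assignment \<open>\<sigma>\<close> of
  indices to centers, not necessarily the nearest ones.\<close>

lemma gcost_le:
  assumes "finite S" "inj_on p I" "\<And>j. j \<in> I \<Longrightarrow> \<sigma> j \<in> S"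
  shows "gcost \<phi> m (p ` I) S \<le> (\<Sum>j\<in>I. \<phi> (eucl_dist m (p j) (\<sigma> j)))"
  unfolding gcost_def sum.reindex[OF assms(2)] o_def using assms
  by (intro sum_mono Min_le) auto

end

lemma cost_profile_square: "cost_profile (\<lambda>t. t\<^sup>2)"
  by standard (auto simp: power2_eq_square mult_left_le intro: mult_mono)

lemma cost_profile_ident: "cost_profile (\<lambda>t. t)"
  by standard (auto simp: power2_eq_square mult_left_le)

lemma opt_cost_le:
  assumes "finite Y" "S \<subseteq> Y" "card S = k"
  shows "opt_cost cost k Y \<le> cost S"
  unfolding opt_cost_def using assms by (intro Min_le) auto

lemma opt_cost_ge:
  assumes "finite Y" "k \<le> card Y" "\<And>S. S \<subseteq> Y \<Longrightarrow> card S = k \<Longrightarrow> c \<le> cost S"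
  shows "c \<le> opt_cost cost k Y"
proof -
  \<comment> \<open>A candidate set must exist, since \<open>Min {}\<close> is an unspecified
    value.\<close>
  obtain T where "T \<subseteq> Y" "card T = k"
    using obtain_subset_with_card_n[OF assms(2)] by metis
  then show ?thesis
    unfolding opt_cost_def using assms by (subst Min_ge_iff) auto
qed

section \<open>Square-root snowflakes of the line\<close>

text \<open>Under \<open>f\<close> a ball of radius \<open>r\<close> lies in an interval of length
  \<open>2 * r\<^sup>2\<close>, while two points whose values differ by at most
  \<open>r\<^sup>2 / 4\<close> are within distance \<open>r / 2\<close>. Eight cells of that length
  plus one for the right end point cover the interval.\<close>

lemma doubling_constant_snowflake:
  fixes f :: "(nat \<Rightarrow> real) \<Rightarrow> real"
  assumes X: "finite X"
    and f: "\<And>x y. x \<in> X \<Longrightarrow> y \<in> X \<Longrightarrow> eucl_dist m x y = sqrt \<bar>f x - f y\<bar>"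
  shows "doubling_constant m X \<le> 9"
  unfolding doubling_constant_def
proof (rule Least_le, intro ballI allI impI)
  fix x :: "nat \<Rightarrow> real" and r :: real
  assume x: "x \<in> X" and r: "0 < r"
  define B where "B = {y\<in>X. eucl_dist m x y \<le> r}"
  define c where "c y = \<lfloor>(f y - f x + r\<^sup>2) / (r\<^sup>2 / 4)\<rfloor>" for y
  have "c y \<in> {0..8}" if "y \<in> B" for y
  proof -
    have "sqrt \<bar>f x - f y\<bar> \<le> r" using that x f by (auto simp: B_def)
    then have "\<bar>f x - f y\<bar> \<le> r\<^sup>2" by (metis real_sqrt_le_iff real_sqrt_unique r less_imp_le)
    then have "0 \<le> (f y - f x + r\<^sup>2) / (r\<^sup>2 / 4)" "(f y - f x + r\<^sup>2) / (r\<^sup>2 / 4) \<le> 8"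
      using r by (auto simp: field_simps)
    then have "0 \<le> c y" "c y < 9"
      unfolding c_def by (auto simp: floor_less_iff)
    then show ?thesis by simp
  qed
  then have "c ` B \<subseteq> {0..8}" by auto
  then have card9: "card (c ` B) \<le> 9" using card_mono[of "{0..8::int}" "c ` B"] by simp
  \<comment> \<open>One representative for each cell that meets the ball.\<close>
  obtain S where S: "S \<subseteq> B" "inj_on c S" "c ` B = c ` S"
    by (metis subset_image_inj order_refl)
  have finB: "finite B" using X by (simp add: B_def)
  have "card S \<le> 9" using card9 S by (metis card_image)
  moreover have "B \<subseteq> (\<Union>s\<in>S. {y\<in>X. eucl_dist m s y \<le> r / 2})"
  proof
    fix y assume y: "y \<in> B"
    then obtain s where s: "s \<in> S" "c y = c s" using S(3) by auto
    have "\<bar>(f y - f x + r\<^sup>2) / (r\<^sup>2 / 4) - (f s - f x + r\<^sup>2) / (r\<^sup>2 / 4)\<bar> < 1"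
      using s(2) unfolding c_def by linarith
    also have "(f y - f x + r\<^sup>2) / (r\<^sup>2 / 4) - (f s - f x + r\<^sup>2) / (r\<^sup>2 / 4) = (f y - f s) / (r\<^sup>2 / 4)"
      using r by (simp add: field_simps)
    finally have "\<bar>f y - f s\<bar> / (r\<^sup>2 / 4) < 1"
      using r by (subst (asm) abs_divide) simp
    then have "\<bar>f s - f y\<bar> \<le> (r / 2)\<^sup>2"
      using r by (simp add: power_divide pos_divide_less_eq abs_minus_commute)
    then have "sqrt \<bar>f s - f y\<bar> \<le> r / 2" using r by (intro real_le_lsqrt) auto
    moreover have "s \<in> X" "y \<in> X" using s(1) S(1) y by (auto simp: B_def)
    ultimately have "eucl_dist m s y \<le> r / 2" using f by simp
    then show "y \<in> (\<Union>s\<in>S. {y\<in>X. eucl_dist m s y \<le> r / 2})"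
      using s(1) \<open>y \<in> X\<close> by auto
  qed
  ultimately show "\<exists>S\<subseteq>X. finite S \<and> card S \<le> 9 \<and>
      {y\<in>X. eucl_dist m x y \<le> r} \<subseteq> (\<Union>s\<in>S. {y\<in>X. eucl_dist m s y \<le> r / 2})"
    using S(1) finite_subset[OF S(1) finB] unfolding B_def by (intro exI[of _ S]) auto
qed

section \<open>Staircase points with orthogonal steps\<close>

definition stair :: "(nat \<Rightarrow> real) \<Rightarrow> nat \<Rightarrow> nat \<Rightarrow> real" where
  "stair w j = (\<lambda>i. if i < j then w i else 0)"

lemma eucl_dist_stair:
  assumes "a \<le> b" "b \<le> m"
  shows "eucl_dist m (stair w a) (stair w b) = sqrt (\<Sum>i=a..<b. (w i)\<^sup>2)"
proof -
  have "(\<Sum>i<m. (stair w a i - stair w b i)\<^sup>2) = (\<Sum>i=a..<b. (stair w a i - stair w b i)\<^sup>2)"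
    using assms by (intro sum.mono_neutral_right) (auto simp: stair_def)
  also have "\<dots> = (\<Sum>i=a..<b. (w i)\<^sup>2)"
    by (intro sum.cong) (auto simp: stair_def)
  finally show ?thesis by (simp add: eucl_dist_def L2_set_def)
qed

lemma eucl_dist_stair_Suc:
  "i < m \<Longrightarrow> eucl_dist m (stair w i) (stair w (Suc i)) = \<bar>w i\<bar>"
  by (subst eucl_dist_stair) auto

lemma eucl_dist_stair_ge:
  assumes "a \<le> i" "i < b" "b \<le> m"
  shows "w i \<le> eucl_dist m (stair w a) (stair w b)"
proof -
  have "(w i)\<^sup>2 \<le> (\<Sum>i=a..<b. (w i)\<^sup>2)"
    using assms by (intro member_le_sum) auto
  then show ?thesis using assms by (subst eucl_dist_stair) (auto intro: real_le_rsqrt)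
qed

lemma inj_on_stair:
  assumes "\<And>i. i < n \<Longrightarrow> 0 < w i"
  shows "inj_on (stair w) {..n}"
proof (rule linorder_inj_onI)
  fix a b assume "a < b" "a \<in> {..n}" "b \<in> {..n}"
  then show "stair w a \<noteq> stair w b"
    using assms[of a] by (auto simp: stair_def fun_eq_iff intro!: exI[of _ a])
qed auto

lemma doubling_dim_stair:
  assumes "0 < n" and pos: "\<And>i. i < n \<Longrightarrow> 0 < w i"
  shows "doubling_dim n (stair w ` {..<n}) \<le> 4"
proof -
  let ?X = "stair w ` {..<n}"
  have inj: "inj_on (stair w) {..<n}"
    using inj_on_stair[of n w, OF pos] by (rule inj_on_subset) auto
  \<comment> \<open>The position on the line whose square root gives the metric: the sum of the
    squared edge lengths up to the point.\<close>
  define f where "f x = (\<Sum>i<the_inv_into {..<n} (stair w) x. (w i)\<^sup>2)" for x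
  have f: "f (stair w j) = (\<Sum>i<j. (w i)\<^sup>2)" if "j < n" for j
    using that by (simp add: f_def the_inv_into_f_f[OF inj])
  have D: "eucl_dist n (stair w a) (stair w b) = sqrt \<bar>f (stair w a) - f (stair w b)\<bar>"
    if "a \<le> b" "b < n" for a b
  proof -
    have "(\<Sum>i<b. (w i)\<^sup>2) = (\<Sum>i<a. (w i)\<^sup>2) + (\<Sum>i=a..<b. (w i)\<^sup>2)"
      using that by (metis atLeast0LessThan le0 sum.atLeastLessThan_concat)
    then have "\<bar>f (stair w a) - f (stair w b)\<bar> = (\<Sum>i=a..<b. (w i)\<^sup>2)"
      using that f by (simp add: sum_nonneg)
    then show ?thesis using that by (simp add: eucl_dist_stair)
  qed
  have "eucl_dist n x y = sqrt \<bar>f x - f y\<bar>" if xy: "x \<in> ?X" "y \<in> ?X" for x y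
  proof -
    obtain a b where ab: "x = stair w a" "y = stair w b" "a < n" "b < n" using xy by auto
    show ?thesis
    proof (cases "a \<le> b")
      case True
      then show ?thesis using D ab by simp
    next
      case False
      then show ?thesis using D[of b a] ab by (simp add: eucl_dist_commute abs_minus_commute)
    qed
  qed
  then have "doubling_constant n ?X \<le> 9" by (intro doubling_constant_snowflake) auto
  \<comment> \<open>Here \<open>9 \<le> 2 ^ 4\<close>; the value 0 is split off because monotonicity
    of the logarithm needs a positive argument.\<close>
  then have "log 2 (doubling_constant n ?X) \<le> log 2 (2 ^ 4)"
    by (cases "doubling_constant n ?X = 0") (simp_all add: log_def divide_right_mono)
  moreover have "log 2 (2 ^ 4 :: real) = 4" by (subst log_nat_power) auto
  ultimately show ?thesis unfolding doubling_dim_def by linarith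
qed

section \<open>A chain of clusters and its projection\<close>

text \<open>
  The clusters are the first \<open>k\<close> points of the chain and the remaining \<open>n - k\<close> points taken
  together. The length \<open>R\<close> of edge \<open>1\<close> is chosen so large that this edge stays long in the
  projection; the only purpose of the edges of negligible length \<open>\<eta>\<close> is to reach \<open>n\<close> points.
\<close>

definition weight :: "nat \<Rightarrow> real \<Rightarrow> real \<Rightarrow> real \<Rightarrow> nat \<Rightarrow> real" where
  "weight k u R \<eta> i = (if i = 0 then 1 else if i = 1 then R else if i < k then 1 / u else \<eta>)"

text \<open>With \<open>1 / u \<le> R\<close>, edge 1 is also expensive in the original space, so
  edge 0 is the only cheap one among the first \<open>k\<close>. The bound on \<open>\<eta>\<close>
  keeps the total cost of the last cluster at most 1 even if each of the \<open>n\<close> points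
  pays for the whole tail.\<close>

locale chain = cost_profile +
  fixes n k :: nat and u R \<eta> :: real
  assumes k: "3 \<le> k" "k < n"
    and u: "0 < u" "u \<le> 1 / 4"
    and R: "1 / u \<le> R"
    and \<eta>: "0 < \<eta>" "(real n)\<^sup>2 * \<eta> \<le> u\<^sup>2 / 2"
begin

abbreviation "w \<equiv> weight k u R \<eta>"
abbreviation "p \<equiv> stair w"
abbreviation "X \<equiv> p ` {..<n}"

lemma K_ge_4: "4 \<le> 1 / u"
  using u by (simp add: field_simps)

lemma n_\<eta>_le: "real n * \<eta> \<le> u\<^sup>2 / 2" "n * (n * \<eta>) \<le> 1" "\<eta> \<le> 1"
proof -
  have "real n * \<eta> \<le> (real n)\<^sup>2 * \<eta>"
    using k \<eta>(1) by (intro mult_right_mono) (simp_all add: power2_eq_square less_imp_le)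
  then show 1: "real n * \<eta> \<le> u\<^sup>2 / 2" using \<eta>(2) by (rule order_trans)
  have "u\<^sup>2 / 2 \<le> 1" using u power_le_one[of u 2] by simp
  then show "n * (n * \<eta>) \<le> 1" using \<eta> by (simp add: power2_eq_square algebra_simps)
  have "\<eta> \<le> real n * \<eta>" using k \<eta> by simp
  then show "\<eta> \<le> 1" using 1 \<open>u\<^sup>2 / 2 \<le> 1\<close> by simp
qed

lemma w_pos: "0 < w i"
  using u R K_ge_4 \<eta> unfolding weight_def by auto

lemma w_ge_1: "i < k \<Longrightarrow> 1 \<le> w i"
  using K_ge_4 R by (auto simp: weight_def)

lemma w_ge_K: "1 \<le> i \<Longrightarrow> i < k \<Longrightarrow> 1 / u \<le> w i"
  using R by (auto simp: weight_def)

lemma inj_p: "inj_on p {..<n}"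
  by (rule inj_on_subset[OF inj_on_stair[of n]]) (auto simp: w_pos)

lemma card_X: "card X = n"
  using inj_p by (simp add: card_image)

lemma dist_p_le:
  assumes "a \<le> b" "b \<le> n"
  shows "eucl_dist n (p a) (p b) \<le> (\<Sum>i=a..<b. w i)"
proof -
  have "(\<Sum>i=a..<b. eucl_dist n (p i) (p (Suc i))) = (\<Sum>i=a..<b. w i)"
    using assms w_pos by (intro sum.cong) (auto simp: eucl_dist_stair_Suc less_imp_le)
  then show ?thesis using eucl_dist_chain[OF assms(1), of n p] by simp
qed

lemma tail_sum_le:
  assumes "k \<le> a" "b \<le> n"
  shows "(\<Sum>i=a..<b. w i) \<le> n * \<eta>"
proof -
  have "(\<Sum>i=a..<b. w i) = (\<Sum>i=a..<b. \<eta>)"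
    using assms k by (intro sum.cong) (auto simp: weight_def)
  also have "\<dots> \<le> n * \<eta>" using assms \<eta> by (simp add: mult_right_mono)
  finally show ?thesis .
qed

text \<open>Pigeonhole: \<open>\<lambda>j. min j k\<close> maps indices to the \<open>k + 1\<close>
  clusters, and \<open>k\<close> centers cannot meet them all. The first point of a missed cluster
  \<open>c\<close> is separated from every center by one of the edges \<open>c - 1\<close> and
  \<open>c\<close>.\<close>

lemma missed_cluster:
  assumes S: "S \<subseteq> X" "card S = k"
  obtains c where "c \<le> k" "p c \<notin> S"
    "\<And>s. s \<in> S \<Longrightarrow> \<exists>i<k. (i = c \<or> Suc i = c) \<and> w i \<le> eucl_dist n (p c) s"
proof -
  obtain J where J: "J \<subseteq> {..<n}" "inj_on p J" "S = p ` J"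
    using S(1) by (metis subset_image_inj)
  have "finite J" using J(1) finite_subset by blast
  then have "card ((\<lambda>j. min j k) ` J) \<le> k"
    using card_image_le[of J] S J by (metis card_image)
  then have "\<not> {..k} \<subseteq> (\<lambda>j. min j k) ` J"
    using card_mono[of "(\<lambda>j. min j k) ` J" "{..k}"] \<open>finite J\<close> by auto
  then obtain c where c: "c \<le> k" "c \<notin> (\<lambda>j. min j k) ` J" by auto
  have far: "\<exists>i<k. (i = c \<or> Suc i = c) \<and> w i \<le> eucl_dist n (p c) (p j)" if j: "j \<in> J" for j
  proof -
    have jn: "j < n" and cj: "c \<noteq> min j k" using j J c(2) by auto
    show ?thesis
    \<comment> \<open>A center on the left lies beyond edge \<open>c - 1\<close>. One on the right
      lies beyond edge \<open>c\<close>, and this forces \<open>c < k\<close>, as all indices from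
      \<open>k\<close> on belong to cluster \<open>k\<close>.\<close>
    proof (cases "j < c")
      case True
      then show ?thesis
        using eucl_dist_stair_ge[of j "c - 1" c n w] c(1) k
        by (intro exI[of _ "c - 1"]) (auto simp: eucl_dist_commute)
    next
      case False
      then have "c < j" "c < k" using cj c(1) by auto
      then show ?thesis
        using eucl_dist_stair_ge[of c c j n w] jn by (intro exI[of _ c]) auto
    qed
  qed
  moreover have "p c \<notin> S"
  proof
    assume "p c \<in> S"
    then obtain i where "i < k" "w i \<le> 0" using far J(3) by force
    then show False using w_pos[of i] by simp
  qed
  ultimately show ?thesis using that[of c] c(1) J(3) by auto
qed

lemma gcost_X_ge_1:
  assumes S: "S \<subseteq> X" "card S = k"
  shows "1 \<le> gcost \<phi> n X S"
proof -
  obtain c where c: "c \<le> k"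
    "\<And>s. s \<in> S \<Longrightarrow> \<exists>i<k. (i = c \<or> Suc i = c) \<and> w i \<le> eucl_dist n (p c) s"
    using missed_cluster[OF S] by metis
  have "finite S" "S \<noteq> {}" using S k card.infinite by (fastforce, auto)
  then have "\<phi> 1 \<le> gcost \<phi> n X S"
  proof (intro gcost_ge[of _ "p c"])
    fix s assume "s \<in> S"
    then obtain i where "i < k" "w i \<le> eucl_dist n (p c) s" using c by blast
    then show "1 \<le> eucl_dist n (p c) s" using w_ge_1[of i] by linarith
  qed (use c k in auto)
  then show ?thesis using large_ge[of 1] by simp
qed

text \<open>If \<open>p 0\<close> and \<open>p 1\<close> are both centers, the missed cluster has
  index at least 2, so it does not touch edge 0, and the edges bounding it have length at least
  \<open>1 / u\<close>.\<close>

lemma expensive_unless_cheap_edge: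
  assumes S: "S \<subseteq> X" "card S = k" and cost: "gcost \<phi> n X S < 1 / u"
  shows "p 0 \<notin> S \<or> p 1 \<notin> S"
proof (rule ccontr)
  assume contra: "\<not> ?thesis"
  obtain c where c: "c \<le> k" "p c \<notin> S"
    "\<And>s. s \<in> S \<Longrightarrow> \<exists>i<k. (i = c \<or> Suc i = c) \<and> w i \<le> eucl_dist n (p c) s"
    using missed_cluster[OF S] by metis
  have c2: "2 \<le> c" using c(2) contra by (cases c; cases "c - 1") auto
  have "finite S" "S \<noteq> {}" using S k card.infinite by (fastforce, auto)
  then have "\<phi> (1 / u) \<le> gcost \<phi> n X S"
  proof (intro gcost_ge[of _ "p c"])
    fix s assume "s \<in> S"
    then obtain i where "i < k" "i = c \<or> Suc i = c" "w i \<le> eucl_dist n (p c) s" using c by blast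
    then show "1 / u \<le> eucl_dist n (p c) s" using w_ge_K[of i] c2 by fastforce
  qed (use c k u in auto)
  then show False using large_ge[of "1 / u"] K_ge_4 cost by simp
qed

lemma opt_cost_X_ge: "1 \<le> opt_cost (gcost \<phi> n X) k X"
  using gcost_X_ge_1 k by (intro opt_cost_ge) (auto simp: card_X)

lemma opt_cost_X_le: "opt_cost (gcost \<phi> n X) k X \<le> 2"
proof -
  \<comment> \<open>The center at \<open>p 0\<close> is dropped: \<open>p 0\<close> is served by
    \<open>p 1\<close> across the edge of length 1, the tail by \<open>p k\<close>.\<close>
  let ?\<sigma> = "\<lambda>j. if j = 0 then 1 else if j \<le> k then j else k"
  have "opt_cost (gcost \<phi> n X) k X \<le> gcost \<phi> n X (p ` {1..k})"
    using inj_on_subset[OF inj_p, of "{1..k}"] k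
    by (intro opt_cost_le) (auto simp: card_image subset_eq)
  also have "\<dots> \<le> (\<Sum>j<n. \<phi> (eucl_dist n (p j) (p (?\<sigma> j))))"
    using k inj_p by (intro gcost_le) auto
  also have "\<dots> \<le> (\<Sum>j<n. (if j = 0 then 1 else 0) + n * \<eta>)"
  proof (rule sum_mono)
    fix j assume "j \<in> {..<n}"
    consider "j = 0" | "j \<noteq> 0" "j \<le> k" | "k < j" by linarith
    then show "\<phi> (eucl_dist n (p j) (p (?\<sigma> j))) \<le> (if j = 0 then 1 else 0) + n * \<eta>"
    proof cases
      case 1
      have "eucl_dist n (p 0) (p (Suc 0)) = 1"
        using k by (subst eucl_dist_stair_Suc) (auto simp: weight_def)
      moreover have "0 \<le> n * \<eta>" using \<eta> by simp
      ultimately show ?thesis using 1 small_le[of 1] by simp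
    next
      case 2
      moreover have "0 \<le> n * \<eta>" using \<eta> by simp
      ultimately show ?thesis using small_le[of 0] by simp
    next
      case 3
      then have d: "eucl_dist n (p j) (p k) \<le> n * \<eta>"
        using dist_p_le[of k j] tail_sum_le[of k j] \<open>j \<in> _\<close> by (simp add: eucl_dist_commute)
      also have "n * \<eta> \<le> n * (n * \<eta>)"
        using k \<eta> by (simp add: mult_left_mono)
      finally have "eucl_dist n (p j) (p k) \<le> 1" using n_\<eta>_le by simp
      then show ?thesis
        using 3 d small_le[of "eucl_dist n (p j) (p k)"] by simp
    qed
  qed
  also have "\<dots> = 1 + n * (n * \<eta>)"
    using k by (simp add: sum.distrib)
  also have "\<dots> \<le> 2" using n_\<eta>_le by simp
  finally show ?thesis .
qed


end

text \<open>Deterministic conditions under which the projection misleads. \<open>q\<close> is the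
  image of the chain and \<open>N i\<close> the factor by which edge \<open>i\<close> is scaled,
  later the norm of column \<open>i\<close> of the matrix. \<open>e\<close> is a collapsed expensive
  edge; \<open>M\<close> and \<open>\<theta>\<close> control the overall stretch and the shrinking
  of edge 1.\<close>

locale projected_chain = chain +
  fixes d :: nat and q :: "nat \<Rightarrow> nat \<Rightarrow> real" and N :: "nat \<Rightarrow> real"
    and M \<theta> :: real and e :: nat
  assumes inj_q: "inj_on q {..<n}"
    and edge: "\<And>i. Suc i < n \<Longrightarrow> eucl_dist d (q i) (q (Suc i)) = w i * N i"
    and N_nonneg: "\<And>i. 0 \<le> N i"
    and M: "1 \<le> M" "(\<Sum>i<n. N i) \<le> M"
    and \<theta>: "0 < \<theta>" "\<theta> \<le> N 1"
    and R_large: "M / u + 1 \<le> R * \<theta>"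
    and \<eta>_small: "(real n)\<^sup>2 * \<eta> * M \<le> u\<^sup>2 / 2"
    and N0: "u < N 0"
    and e: "2 \<le> e" "e < k" "N e \<le> u ^ 4"
begin

abbreviation "Q \<equiv> q ` {..<n}"

lemma card_Q: "card Q = n"
  using inj_q by (simp add: card_image)

lemma dist_q_le:
  assumes "a \<le> b" "b < n"
  shows "eucl_dist d (q a) (q b) \<le> (\<Sum>i=a..<b. w i * N i)"
proof -
  have "(\<Sum>i=a..<b. eucl_dist d (q i) (q (Suc i))) = (\<Sum>i=a..<b. w i * N i)"
    using assms by (intro sum.cong) (auto simp: edge)
  then show ?thesis using eucl_dist_chain[OF assms(1), of d q] by simp
qed

lemma dist_q_le_bounded_weights:
  assumes "a \<le> b" "b < n" "0 \<le> c" "\<And>i. a \<le> i \<Longrightarrow> i < b \<Longrightarrow> w i \<le> c"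
  shows "eucl_dist d (q a) (q b) \<le> c * M"
proof -
  have "eucl_dist d (q a) (q b) \<le> (\<Sum>i=a..<b. w i * N i)" by (rule dist_q_le[OF assms(1,2)])
  also have "\<dots> \<le> (\<Sum>i=a..<b. c * N i)"
    using assms N_nonneg by (intro sum_mono mult_right_mono) auto
  also have "\<dots> \<le> (\<Sum>i<n. c * N i)"
    using assms N_nonneg by (intro sum_mono2) auto
  also have "\<dots> \<le> c * M"
    using M assms(3) by (simp add: sum_distrib_left[symmetric] mult_left_mono)
  finally show ?thesis .
qed

text \<open>Orthogonality is lost in the image, so other edges might fold back and cancel edge 1.
  But edge 1 keeps length at least \<open>R * \<theta>\<close>, while the rest of the path from
  \<open>q 1\<close> to \<open>q 2\<close> through \<open>q a\<close> and \<open>q b\<close> has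
  length at most \<open>M / u\<close>; the triangle inequality leaves at least 1 for the remaining
  distance.\<close>

lemma long_edge_survives:
  assumes "a \<in> {0, 1}" "2 \<le> b" "b < n"
  shows "u \<le> eucl_dist d (q a) (q b)"
proof -
  have "N 0 + eucl_dist d (q 2) (q b) \<le> M / u"
  proof -
    have "eucl_dist d (q 2) (q b) \<le> (\<Sum>i=2..<b. w i * N i)" using assms by (intro dist_q_le) auto
    also have "\<dots> \<le> (\<Sum>i=2..<b. 1 / u * N i)"
      using n_\<eta>_le(3) K_ge_4 N_nonneg
      by (intro sum_mono mult_right_mono) (auto simp: weight_def)
    finally have "N 0 + eucl_dist d (q 2) (q b) \<le> 1 / u * N 0 + (\<Sum>i=2..<b. 1 / u * N i)"
      using mult_right_mono[of 1 "1 / u" "N 0"] K_ge_4 N_nonneg[of 0] by simp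
    also have "\<dots> = (\<Sum>i\<in>insert 0 {2..<b}. 1 / u * N i)" by simp
    also have "\<dots> \<le> (\<Sum>i<n. 1 / u * N i)"
      using assms N_nonneg u by (intro sum_mono2) auto
    also have "\<dots> \<le> 1 / u * M"
      unfolding sum_distrib_left[symmetric] using M u by (intro mult_left_mono) auto
    finally show ?thesis by simp
  qed
  moreover have "R * N 1 = eucl_dist d (q 1) (q 2)"
    using edge[of 1] k by (simp add: weight_def numeral_2_eq_2)
  moreover have "eucl_dist d (q 1) (q 2) \<le> N 0 + eucl_dist d (q a) (q b) + eucl_dist d (q 2) (q b)"
  proof -
    have "eucl_dist d (q 1) (q a) \<le> N 0"
      using assms(1) edge[of 0] k N_nonneg[of 0] by (auto simp: weight_def eucl_dist_commute)
    then show ?thesis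
      using eucl_dist_triangle[of d "q 1" "q 2" "q a"] eucl_dist_triangle[of d "q a" "q 2" "q b"]
      by (simp add: eucl_dist_commute)
  qed
  moreover have "R * \<theta> \<le> R * N 1"
    using \<theta> R K_ge_4 by (intro mult_left_mono) auto
  ultimately show ?thesis using R_large u by linarith
qed

text \<open>An omitted \<open>q 0\<close> or \<open>q 1\<close> is served either by the other one,
  at distance \<open>N 0 > u\<close>, or across edge 1. Since \<open>u < 1\<close>,
  \<open>\<phi> u\<close> can be as small as \<open>u\<^sup>2\<close>.\<close>

lemma gcost_missing_ge:
  assumes T: "T \<subseteq> Q" "card T = k" and a: "a \<in> {0, 1}" "q a \<notin> T"
  shows "u\<^sup>2 \<le> gcost \<phi> d Q T"
proof -
  have "finite T" "T \<noteq> {}" using T k card.infinite by (fastforce, auto)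
  then have "\<phi> u \<le> gcost \<phi> d Q T"
  proof (intro gcost_ge[of _ "q a"])
    fix s assume "s \<in> T"
    then obtain b where "b < n" "s = q b" using T by auto
    moreover have "s \<noteq> q a" using a \<open>s \<in> T\<close> by auto
    ultimately have b: "b < n" "s = q b" "b \<noteq> a" by auto
    show "u \<le> eucl_dist d (q a) s"
    proof (cases "2 \<le> b")
      case True
      then show ?thesis using long_edge_survives a b by simp
    next
      case False
      then have "{a, b} = {0, 1}" using a b by auto
      then have "eucl_dist d (q a) s = N 0"
        using b edge[of 0] k by (auto simp: doubleton_eq_iff weight_def eucl_dist_commute)
      then show ?thesis using N0 by simp
    qed
  qed (use a k u in auto)
  moreover have "u\<^sup>2 \<le> \<phi> u" using u by (intro small_ge) auto
  ultimately show ?thesis by simp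
qed

lemma opt_cost_Q_less: "opt_cost (gcost \<phi> d Q) k Q < u\<^sup>2"
proof -
  \<comment> \<open>Now the center at \<open>q e\<close> is dropped: it is served across the
    collapsed edge, of length at most \<open>1 / u * u ^ 4 = u ^ 3\<close>. Serving the tail from
    \<open>q k\<close> costs at most \<open>\<eta> * M\<close> per point.\<close>
  let ?\<sigma> = "\<lambda>j. if j = e then Suc e else if j \<le> k then j else k"
  have "{..k} - {e} \<subseteq> {..<n}" using k by auto
  moreover have "card ({..k} - {e}) = k" using e by simp
  ultimately have "opt_cost (gcost \<phi> d Q) k Q \<le> gcost \<phi> d Q (q ` ({..k} - {e}))"
    using inj_on_subset[OF inj_q, of "{..k} - {e}"]
    by (intro opt_cost_le) (auto simp: card_image)
  also have "\<dots> \<le> (\<Sum>j<n. \<phi> (eucl_dist d (q j) (q (?\<sigma> j))))"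
    using k e inj_q by (intro gcost_le) auto
  also have "\<dots> \<le> (\<Sum>j<n. (if j = e then u ^ 3 else 0) + \<eta> * M)"
  proof (rule sum_mono)
    fix j assume "j \<in> {..<n}"
    consider "j = e" | "j \<noteq> e" "j \<le> k" | "j \<noteq> e" "k < j" by linarith
    then show "\<phi> (eucl_dist d (q j) (q (?\<sigma> j))) \<le> (if j = e then u ^ 3 else 0) + \<eta> * M"
    proof cases
      case 1
      have "eucl_dist d (q e) (q (Suc e)) = 1 / u * N e"
        using k e by (subst edge) (auto simp: weight_def)
      also have "\<dots> \<le> 1 / u * u ^ 4"
        using e u by (intro mult_left_mono) auto
      also have "\<dots> = u ^ 3" using u by (simp add: eval_nat_numeral)
      finally have "eucl_dist d (q e) (q (Suc e)) \<le> u ^ 3" .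
      moreover have "u ^ 3 \<le> 1" using u by (intro power_le_one) auto
      moreover have "0 \<le> \<eta> * M" using M \<eta> by simp
      ultimately show ?thesis
        using 1 small_le[of "eucl_dist d (q e) (q (Suc e))"] by simp
    next
      case 2
      moreover have "0 \<le> \<eta> * M" using M \<eta> by simp
      ultimately show ?thesis using small_le[of 0] by simp
    next
      case 3
      have "eucl_dist d (q k) (q j) \<le> \<eta> * M"
        using 3 k \<eta> \<open>j \<in> _\<close> by (intro dist_q_le_bounded_weights) (auto simp: weight_def)
      moreover have "\<eta> * M \<le> (real n)\<^sup>2 * \<eta> * M"
        using k \<eta> M by (simp add: power2_eq_square mult_ge1_I)
      moreover have "u\<^sup>2 / 2 \<le> 1" using u power_le_one[of u 2] by simp
      ultimately show ?thesis
        using 3 \<eta>_small small_le[of "eucl_dist d (q k) (q j)"] by (simp add: eucl_dist_commute)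
    qed
  qed
  also have "\<dots> = u ^ 3 + n * (\<eta> * M)"
    using k e by (simp add: sum.distrib)
  also have "n * (\<eta> * M) \<le> n * (n * (\<eta> * M))"
    using k \<eta> M by (intro mult_left_mono) auto
  also have "n * (n * (\<eta> * M)) \<le> u\<^sup>2 / 2"
    using \<eta>_small by (simp add: power2_eq_square algebra_simps)
  also have "u ^ 3 + u\<^sup>2 / 2 < u\<^sup>2"
  proof -
    have "u ^ 3 = u\<^sup>2 * u" by (simp add: eval_nat_numeral)
    also have "\<dots> \<le> u\<^sup>2 * (1 / 4)" using u by (intro mult_left_mono) auto
    finally show ?thesis using u zero_less_power[of u 2] by linarith
  qed
  finally show ?thesis by simp
qed

lemma opt_cost_Q_le: "opt_cost (gcost \<phi> d Q) k Q \<le> u\<^sup>2 * opt_cost (gcost \<phi> n X) k X"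
proof -
  have "u\<^sup>2 * 1 \<le> u\<^sup>2 * opt_cost (gcost \<phi> n X) k X"
    using opt_cost_X_ge by (intro mult_left_mono) auto
  then show ?thesis using opt_cost_Q_less by simp
qed

text \<open>The projected optimum is below \<open>u\<^sup>2\<close>, so it must contain
  \<open>q 0\<close> and \<open>q 1\<close>. The pulled back centers then contain \<open>p 0\<close>
  and \<open>p 1\<close> and cost at least \<open>1 / u\<close>, against an optimum of at most
  2.\<close>

lemma pull_back_expensive:
  assumes T: "is_opt_centers (gcost \<phi> d Q) k Q T"
    and h: "\<And>j. j < n \<Longrightarrow> h (p j) = q j"
  shows "1 / (2 * u) * opt_cost (gcost \<phi> n X) k X \<le> gcost \<phi> n X {x \<in> X. h x \<in> T}"
proof -
  let ?S = "{x \<in> X. h x \<in> T}"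
  have TQ: "T \<subseteq> Q" "card T = k"
    and min: "\<And>T'. T' \<subseteq> Q \<Longrightarrow> card T' = k \<Longrightarrow> gcost \<phi> d Q T \<le> gcost \<phi> d Q T'"
    using T by (auto simp: is_opt_centers_def is_arg_min_linorder)
  have "gcost \<phi> d Q T \<le> opt_cost (gcost \<phi> d Q) k Q"
    using min k by (intro opt_cost_ge) (auto simp: card_Q)
  then have less: "gcost \<phi> d Q T < u\<^sup>2" using opt_cost_Q_less by simp
  \<comment> \<open>Injectivity of \<open>q\<close> ensures that the pull-back again has exactly
    \<open>k\<close> points.\<close>
  have "bij_betw h ?S T"
    unfolding bij_betw_def
  proof
    show "inj_on h ?S" using h inj_q by (fastforce simp: inj_on_def)
    show "h ` ?S = T" using h TQ(1) by (force simp: image_iff)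
  qed
  then have card: "card ?S = k" using TQ by (simp add: bij_betw_same_card)
  have "q 0 \<in> T" "q 1 \<in> T" using gcost_missing_ge[OF TQ] less by force+
  then have "p 0 \<in> ?S" "p 1 \<in> ?S" using h k by auto
  then have ge: "1 / u \<le> gcost \<phi> n X ?S"
    using expensive_unless_cheap_edge[of ?S] card by force
  have "1 / (2 * u) * opt_cost (gcost \<phi> n X) k X \<le> 1 / (2 * u) * 2"
    using opt_cost_X_le u by (intro mult_left_mono) auto
  then show ?thesis using ge by simp
qed

end

section \<open>Columns of a Gaussian matrix\<close>

abbreviation entry :: "nat \<Rightarrow> real measure" where
  "entry d \<equiv> density lborel (\<lambda>t. ennreal (normal_density 0 (sqrt (1 / real d)) t))"

text \<open>The length of the image of the \<open>j\<close>-th unit vector, hence the scaling factor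
  of edge \<open>j\<close>.\<close>

definition col_norm :: "nat \<Rightarrow> (nat \<times> nat \<Rightarrow> real) \<Rightarrow> nat \<Rightarrow> real" where
  "col_norm d G j = L2_set (\<lambda>i. G (i, j)) {..<d}"

locale gaussian =
  fixes d m :: nat
  assumes d: "1 \<le> d"
begin

sublocale entry: prob_space "entry d"
  using d by (intro prob_space_normal_density) simp

sublocale P: product_prob_space "\<lambda>_. entry d" "{..<d} \<times> {..<m}"
  by standard

abbreviation "\<G> \<equiv> gaussian_matrix d m"

sublocale G: prob_space \<G>
  unfolding gaussian_matrix_def by (rule P.prob_space_axioms)

section \<open>Gaussian entries: measurability, distribution, independence\<close>

lemma measurable_entry:
  assumes "i < d" "j < m"
  shows "(\<lambda>G. G (i, j)) \<in> borel_measurable \<G>"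
proof -
  have "(\<lambda>G. G (i, j)) \<in> measurable \<G> (entry d)"
    unfolding gaussian_matrix_def using assms by (intro measurable_component_singleton) auto
  then show ?thesis by simp
qed

lemma measurable_col_norm [measurable]:
  assumes "j < m"
  shows "(\<lambda>G. col_norm d G j) \<in> borel_measurable \<G>"
proof -
  have "(\<lambda>G. sqrt (\<Sum>i<d. (G (i, j))\<^sup>2)) \<in> borel_measurable \<G>"
    using assms by (intro measurable_compose[OF _ borel_measurable_sqrt] borel_measurable_sum
        borel_measurable_power measurable_entry) auto
  then show ?thesis by (simp add: col_norm_def L2_set_def)
qed

lemma distributed_entry:
  assumes "i < d" "j < m"
  shows "distributed \<G> lborel (\<lambda>G. G (i, j)) (normal_density 0 (sqrt (1 / d)))"
proof -
  have "distr \<G> (entry d) (\<lambda>G. G (i, j)) = entry d"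
    unfolding gaussian_matrix_def
    using P.PiM_component[of "(i, j)"] assms by simp
  moreover have "distr \<G> (entry d) (\<lambda>G. G (i, j)) = distr \<G> lborel (\<lambda>G. G (i, j))"
    by (intro distr_cong) auto
  ultimately show ?thesis using measurable_entry[OF assms] by (auto simp: distributed_def)
qed

lemma indep_entries: "G.indep_vars (\<lambda>_. entry d) (\<lambda>ij G. G ij) ({..<d} \<times> {..<m})"
\<comment> \<open>The criterion through the joint distribution requires a nonempty index set, and
  \<open>m\<close> may be 0 here.\<close>
proof (cases "{..<d} \<times> {..<m} = {}")
  case True
  have empty: "G.indep_vars M' X {}" for M' :: "nat \<times> nat \<Rightarrow> real measure" and X
    by (simp add: G.indep_vars_def2 G.indep_sets_def)
  show ?thesis unfolding True by (rule empty)
next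
  case False
  have sing: "(\<lambda>G. G ij) \<in> measurable \<G> (entry d)" if "ij \<in> {..<d} \<times> {..<m}" for ij
    unfolding gaussian_matrix_def using that by (rule measurable_component_singleton)
  have "distr \<G> (\<Pi>\<^sub>M i\<in>{..<d} \<times> {..<m}. entry d) (\<lambda>G. \<lambda>i\<in>{..<d} \<times> {..<m}. G i) = \<G>"
  proof -
    have "distr \<G> (\<Pi>\<^sub>M i\<in>{..<d} \<times> {..<m}. entry d) (\<lambda>G. \<lambda>i\<in>{..<d} \<times> {..<m}. G i) = distr \<G> \<G> (\<lambda>G. G)"
      by (intro distr_cong)
         (auto simp: gaussian_matrix_def space_PiM PiE_def extensional_def restrict_def fun_eq_iff)
    then show ?thesis by simp
  qed
  also have "\<G> = (\<Pi>\<^sub>M ij\<in>{..<d} \<times> {..<m}. distr \<G> (entry d) (\<lambda>G. G ij))"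
    unfolding gaussian_matrix_def by (intro PiM_cong refl P.PiM_component[symmetric])
  finally show ?thesis
    using sing False by (subst G.indep_vars_iff_distr_eq_PiM') auto
qed

text \<open>
  Chernoff bound with exponent \<open>d / s\<^sup>2\<close>: the tilted density is dominated by a multiple of the
  normal density of variance \<open>s\<^sup>2 / (2 * d)\<close>. The resulting bound \<open>(3 * s) ^ d\<close> is at most \<open>3 * s\<close>
  for every \<open>d \<ge> 1\<close>.
\<close>

lemma col_norm_small_le:
  assumes j: "j < m" and s: "0 < s"
  shows "measure \<G> {G \<in> space \<G>. col_norm d G j \<le> s} \<le> 3 * s"
proof (cases "3 * s \<le> 1")
  case False
  have "measure \<G> {G \<in> space \<G>. col_norm d G j \<le> s} \<le> 1" by (rule G.prob_le_1)
  then show ?thesis using False by linarith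
next
  case True
  define g where "g x = exp (- (d / s\<^sup>2) * x\<^sup>2)" for x :: real
  \<comment> \<open>The product of these factors over all entries is
    \<open>exp (d - d / s\<^sup>2 * (col_norm d G j)\<^sup>2)\<close>. It is at least 1 on the event
    and its integral factorizes.\<close>
  define f where "f ij x = ennreal (if snd ij = j then exp 1 * g x else 1)"
    for ij :: "nat \<times> nat" and x :: real
  have g_meas [measurable]: "g \<in> borel_measurable borel" unfolding g_def by simp
  have f_meas [measurable]: "f ij \<in> borel_measurable (entry d)" for ij
    unfolding f_def by simp
  have tilt: "normal_density 0 (sqrt (1 / d)) x * g x \<le> s / sqrt 2 * normal_density 0 (s / sqrt (2 * d)) x"
    for x
  proof -
    have "(s / sqrt (2 * d))\<^sup>2 = s\<^sup>2 / (2 * d)" by (simp add: power_divide)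
    then have "- x\<^sup>2 / (2 * (s / sqrt (2 * d))\<^sup>2) = - (d / s\<^sup>2) * x\<^sup>2"
      by simp
    moreover have "s / sqrt 2 * (1 / sqrt (2 * pi * (s / sqrt (2 * d))\<^sup>2)) = 1 / sqrt (2 * pi * (sqrt (1 / d))\<^sup>2)"
      using d s by (simp add: real_sqrt_mult power_divide real_sqrt_divide)
    ultimately have "s / sqrt 2 * normal_density 0 (s / sqrt (2 * d)) x
        = 1 / sqrt (2 * pi * (sqrt (1 / d))\<^sup>2) * g x"
      \<comment> \<open>The tilt \<open>g\<close> is the exponential factor of the narrower density,
        so only the exponential of the original density has to be bounded, by 1.\<close>
      unfolding normal_density_def g_def by (metis (no_types, lifting) diff_0_right mult.assoc)
    moreover have "normal_density 0 (sqrt (1 / d)) x \<le> 1 / sqrt (2 * pi * (sqrt (1 / d))\<^sup>2) * 1"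
      unfolding normal_density_def by (intro mult_left_mono) auto
    then have "normal_density 0 (sqrt (1 / d)) x * g x \<le> 1 / sqrt (2 * pi * (sqrt (1 / d))\<^sup>2) * 1 * g x"
      by (rule mult_right_mono) (simp add: g_def)
    ultimately show ?thesis by (simp only: mult_1_right)
  qed
  have int_g: "(\<integral>\<^sup>+x. ennreal (exp 1 * g x) \<partial>entry d) \<le> ennreal (exp 1 * s / sqrt 2)"
  proof -
    have "(\<integral>\<^sup>+x. ennreal (exp 1 * g x) \<partial>entry d)
        \<le> (\<integral>\<^sup>+x. ennreal (exp 1 * s / sqrt 2) * ennreal (normal_density 0 (s / sqrt (2 * d)) x) \<partial>lborel)"
    proof (subst nn_integral_density)
      show "(\<integral>\<^sup>+x. ennreal (normal_density 0 (sqrt (1 / d)) x) * ennreal (exp 1 * g x) \<partial>lborel)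
        \<le> (\<integral>\<^sup>+x. ennreal (exp 1 * s / sqrt 2) * ennreal (normal_density 0 (s / sqrt (2 * d)) x) \<partial>lborel)"
      proof (rule nn_integral_mono)
        fix x :: real
        have "normal_density 0 (sqrt (1 / d)) x * (exp 1 * g x)
            \<le> exp 1 * s / sqrt 2 * normal_density 0 (s / sqrt (2 * d)) x"
          using mult_left_mono[OF tilt[of x], of "exp 1"] by (simp add: mult.left_commute mult.assoc)
        then show "ennreal (normal_density 0 (sqrt (1 / d)) x) * ennreal (exp 1 * g x)
            \<le> ennreal (exp 1 * s / sqrt 2) * ennreal (normal_density 0 (s / sqrt (2 * d)) x)"
          using s by (simp add: ennreal_mult''[symmetric] g_def ennreal_leI)
      qed
    qed auto
    also have "\<dots> = ennreal (exp 1 * s / sqrt 2)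
        * (\<integral>\<^sup>+x. ennreal (normal_density 0 (s / sqrt (2 * d)) x) \<partial>lborel)"
      by (rule nn_integral_cmult) auto
    also have "(\<integral>\<^sup>+x. ennreal (normal_density 0 (s / sqrt (2 * d)) x) \<partial>lborel) = 1"
      using d s by (subst nn_integral_eq_integral) auto
    finally show ?thesis by simp
  qed
  have int_f: "(\<integral>\<^sup>+x. f ij x \<partial>entry d) \<le> (if snd ij = j then ennreal (exp 1 * s / sqrt 2) else 1)"
    for ij using int_g entry.emeasure_space_1 by (simp add: f_def)
  have prod_cols: "(\<Prod>ij\<in>{..<d} \<times> {..<m}. if snd ij = j then h ij else 1) = (\<Prod>i<d. h (i, j))"
    for h :: "nat \<times> nat \<Rightarrow> ennreal"
  proof -
    have "(\<Prod>ij\<in>{..<d} \<times> {..<m}. if snd ij = j then h ij else 1) = (\<Prod>i<d. \<Prod>j'<m. if j' = j then h (i, j') else 1)"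
      unfolding prod.cartesian_product by (intro prod.cong) auto
    also have "\<dots> = (\<Prod>i<d. h (i, j))" using j by (simp add: prod.delta)
    finally show ?thesis .
  qed
  have "emeasure \<G> {G \<in> space \<G>. col_norm d G j \<le> s}
      = (\<integral>\<^sup>+G. indicator {G \<in> space \<G>. col_norm d G j \<le> s} G \<partial>\<G>)"
    using j by (intro nn_integral_indicator[symmetric]) measurable
  also have "\<dots> \<le> (\<integral>\<^sup>+G. (\<Prod>ij\<in>{..<d} \<times> {..<m}. f ij (G ij)) \<partial>\<G>)"
  proof (rule nn_integral_mono)
    fix G assume "G \<in> space \<G>"
    have "1 \<le> (\<Prod>ij\<in>{..<d} \<times> {..<m}. f ij (G ij))" if "col_norm d G j \<le> s"
    proof -
      have "(\<Sum>i<d. (G (i, j))\<^sup>2) \<le> s\<^sup>2"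
        using that s by (simp add: col_norm_def L2_set_def sqrt_le_D)
      then have "d / s\<^sup>2 * (\<Sum>i<d. (G (i, j))\<^sup>2) \<le> d / s\<^sup>2 * s\<^sup>2"
        by (intro mult_left_mono) auto
      moreover have "(\<Sum>i<d. 1 + - (d / s\<^sup>2) * (G (i, j))\<^sup>2) = d - d / s\<^sup>2 * (\<Sum>i<d. (G (i, j))\<^sup>2)"
        by (simp add: sum_subtractf sum_distrib_left)
      ultimately have "0 \<le> (\<Sum>i<d. 1 + - (d / s\<^sup>2) * (G (i, j))\<^sup>2)"
        using s by simp
      then have "1 \<le> exp (\<Sum>i<d. 1 + - (d / s\<^sup>2) * (G (i, j))\<^sup>2)" by simp
      also have "\<dots> = (\<Prod>i<d. exp 1 * g (G (i, j)))"
        by (simp add: exp_sum exp_add[symmetric] g_def)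
      finally have "1 \<le> ennreal (\<Prod>i<d. exp 1 * g (G (i, j)))" by simp
      also have "\<dots> = (\<Prod>ij\<in>{..<d} \<times> {..<m}. f ij (G ij))"
        unfolding f_def using prod_cols[of "\<lambda>ij. ennreal (exp 1 * g (G ij))"]
        by (simp add: prod_ennreal g_def if_distrib cong: if_cong)
      finally show ?thesis .
    qed
    then show "indicator {G \<in> space \<G>. col_norm d G j \<le> s} G \<le> (\<Prod>ij\<in>{..<d} \<times> {..<m}. f ij (G ij))"
      by (auto simp: indicator_def)
  qed
  also have "\<dots> = (\<Prod>ij\<in>{..<d} \<times> {..<m}. \<integral>\<^sup>+x. f ij x \<partial>entry d)"
    unfolding gaussian_matrix_def by (intro P.product_nn_integral_prod) auto
  also have "\<dots> \<le> (\<Prod>ij\<in>{..<d} \<times> {..<m}. if snd ij = j then ennreal (exp 1 * s / sqrt 2) else 1)"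
    by (intro prod_mono_ennreal int_f)
  also have "\<dots> = ennreal (exp 1 * s / sqrt 2) ^ d"
    unfolding prod_cols by simp
  also have "\<dots> \<le> ennreal (3 * s) ^ d"
  proof -
    have "exp 1 * s / sqrt 2 \<le> exp 1 * s" using s by (intro divide_le_eq[THEN iffD2]) auto
    also have "\<dots> \<le> 3 * s" using s exp_le by (intro mult_right_mono) auto
    finally show ?thesis by (intro power_mono_ennreal ennreal_leI)
  qed
  also have "\<dots> \<le> ennreal (3 * s)"
    using True s d power_decreasing[of 1 d "3 * s"] by (simp add: ennreal_power)
  finally show ?thesis
    using s by (simp add: G.emeasure_eq_measure)
qed

text \<open>On an interval of length \<open>2 * s / sqrt d\<close> the density is at least
  \<open>sqrt d / 6\<close>: the normalization contributes \<open>sqrt d / 3\<close> and the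
  exponential at least \<open>1 / 2\<close>, by \<open>exp x \<ge> 1 + x\<close>.\<close>

lemma entry_small_ge:
  assumes "0 < s" "s \<le> 1"
  shows "s / 3 \<le> measure (entry d) {- (s / sqrt d)..s / sqrt d}"
proof -
  let ?I = "{- (s / sqrt d)..s / sqrt d}"
  have dens: "sqrt d / 6 \<le> normal_density 0 (sqrt (1 / d)) x" if "x \<in> ?I" for x
  proof -
    have "\<bar>x\<bar> \<le> s / sqrt d" using that by auto
    then have "\<bar>x\<bar>\<^sup>2 \<le> (s / sqrt d)\<^sup>2" by (intro power_mono) auto
    then have "x\<^sup>2 * d \<le> s\<^sup>2" using d by (simp add: power_divide field_simps)
    also have "s\<^sup>2 \<le> 1" using assms by (simp add: power_le_one)
    finally have "1 / 2 \<le> exp (- x\<^sup>2 * d / 2)"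
      using exp_ge_add_one_self[of "- x\<^sup>2 * d / 2"] by simp
    moreover have "1 / 3 * sqrt d \<le> 1 / sqrt (2 * pi / d)"
    proof -
      have "sqrt (2 * pi) \<le> 3" using pi_less_4 by (intro real_le_lsqrt) auto
      then show ?thesis using d by (simp add: real_sqrt_divide field_simps)
    qed
    ultimately have "(1 / 3 * sqrt d) * (1 / 2) \<le> 1 / sqrt (2 * pi / d) * exp (- x\<^sup>2 * d / 2)"
      by (intro mult_mono) auto
    then show ?thesis using d by (simp add: normal_density_def)
  qed
  have "ennreal (s / 3) = (\<integral>\<^sup>+x. ennreal (sqrt d / 6) * indicator ?I x \<partial>lborel)"
    using d assms by (simp add: nn_integral_cmult_indicator ennreal_mult''[symmetric])
  also have "\<dots> \<le> (\<integral>\<^sup>+x. ennreal (normal_density 0 (sqrt (1 / d)) x) * indicator ?I x \<partial>lborel)"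
    using dens by (intro nn_integral_mono) (auto simp: indicator_def ennreal_leI)
  also have "\<dots> = emeasure (entry d) ?I"
    by (subst emeasure_density) auto
  finally show ?thesis by (simp add: entry.emeasure_eq_measure)
qed

text \<open>A cube inscribed in the ball of radius \<open>s\<close> stands in for the ball, because
  its probability is a product over the entries.\<close>

lemma column_small_ge:
  assumes s: "0 < s" "s \<le> 1" and j: "j < m"
  shows "(s / 3) ^ d \<le> measure \<G> {G \<in> space \<G>. \<forall>i<d. \<bar>G (i, j)\<bar> \<le> s / sqrt d}"
proof -
  let ?I = "{- (s / sqrt d)..s / sqrt d}"
  have "emeasure \<G> {G \<in> space \<G>. \<forall>ij\<in>{..<d} \<times> {j}. G ij \<in> ?I}
      = (\<Prod>ij\<in>{..<d} \<times> {j}. emeasure (entry d) ?I)"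
    unfolding gaussian_matrix_def using j by (intro P.emeasure_PiM_Collect) auto
  also have "\<dots> = ennreal (measure (entry d) ?I ^ d)"
    by (simp add: entry.emeasure_eq_measure ennreal_power card_cartesian_product)
  finally have "measure \<G> {G \<in> space \<G>. \<forall>ij\<in>{..<d} \<times> {j}. G ij \<in> ?I} = measure (entry d) ?I ^ d"
    by (simp add: G.emeasure_eq_measure)
  moreover have "{G \<in> space \<G>. \<forall>ij\<in>{..<d} \<times> {j}. G ij \<in> ?I}
      = {G \<in> space \<G>. \<forall>i<d. \<bar>G (i, j)\<bar> \<le> s / sqrt d}"
    by (auto simp: abs_le_iff minus_le_iff)
  ultimately show ?thesis
    using power_mono[OF entry_small_ge[OF s], of d] s by simp
qed

lemma col_norm_le:
  assumes "0 \<le> s" "\<And>i. i < d \<Longrightarrow> \<bar>G (i, j)\<bar> \<le> s / sqrt d"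
  shows "col_norm d G j \<le> s"
proof -
  have "(\<Sum>i<d. (G (i, j))\<^sup>2) \<le> (\<Sum>i<d. s\<^sup>2 / d)"
  proof (rule sum_mono)
    fix i assume "i \<in> {..<d}"
    then have "\<bar>G (i, j)\<bar>\<^sup>2 \<le> (s / sqrt d)\<^sup>2" using assms by (intro power_mono) auto
    then show "(G (i, j))\<^sup>2 \<le> s\<^sup>2 / d" by (simp add: power_divide)
  qed
  also have "\<dots> = s\<^sup>2" using d by simp
  finally show ?thesis
    unfolding col_norm_def L2_set_def using assms by (intro real_le_lsqrt) auto
qed

text \<open>A norm above \<open>s\<close> forces the column out of the cube. Distinct columns are
  independent, so the probabilities multiply, and \<open>1 - x \<le> exp (- x)\<close> gives the
  exponential form.\<close>

lemma no_col_norm_small_le: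
  assumes s: "0 < s" "s \<le> 1" and L: "L \<subseteq> {..<m}" "L \<noteq> {}"
  shows "measure \<G> {G \<in> space \<G>. \<forall>j\<in>L. s < col_norm d G j} \<le> exp (- (card L * (s / 3) ^ d))"
proof -
  have finL: "finite L" using L finite_subset by blast
  let ?B = "\<lambda>j. {..<d} \<times> {j}"
  define Y where "Y j G = restrict (\<lambda>ij. G ij) (?B j)" for j :: nat and G :: "nat \<times> nat \<Rightarrow> real"
  define A where "A j = {f \<in> space (PiM (?B j) (\<lambda>_. entry d)). \<not> (\<forall>ij\<in>?B j. \<bar>f ij\<bar> \<le> s / sqrt d)}" for j :: nat
  have ind: "G.indep_vars (\<lambda>j. PiM (?B j) (\<lambda>_. entry d)) Y L"
    unfolding Y_def using L
    by (intro G.indep_vars_restrict[OF indep_entries]) (auto simp: disjoint_family_on_def)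
  have A_sets: "A j \<in> sets (PiM (?B j) (\<lambda>_. entry d))" for j
  proof -
    have comp: "(\<lambda>f. f ij) \<in> borel_measurable (PiM (?B j) (\<lambda>_. entry d))" if "ij \<in> ?B j" for ij
      using measurable_component_singleton[OF that, of "\<lambda>_. entry d"] by simp
    show ?thesis
      unfolding A_def
      by (intro sets.sets_Collect_neg sets.sets_Collect_finite_All borel_measurable_le
          borel_measurable_abs comp borel_measurable_const) auto
  qed
  have Y_A: "Y j -` A j \<inter> space \<G> = space \<G> - {G \<in> space \<G>. \<forall>i<d. \<bar>G (i, j)\<bar> \<le> s / sqrt d}" for j
    by (auto simp: Y_def A_def space_PiM)
  have meas: "{G \<in> space \<G>. \<forall>i<d. \<bar>G (i, j)\<bar> \<le> s / sqrt d} \<in> sets \<G>" if "j \<in> L" for j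
  proof -
    have jm: "j < m" using that L by auto
    have "{G \<in> space \<G>. \<forall>i\<in>{..<d}. \<bar>G (i, j)\<bar> \<le> s / sqrt d} \<in> sets \<G>"
      using jm by (intro sets.sets_Collect_finite_All borel_measurable_le borel_measurable_abs
          measurable_entry borel_measurable_const) auto
    then show ?thesis by (simp only: Ball_def lessThan_iff)
  qed
  have ev: "(\<Inter>j\<in>L. Y j -` A j \<inter> space \<G>) \<in> sets \<G>"
    unfolding Y_A by (rule sets.finite_INT[OF finL L(2)], rule sets.compl_sets, rule meas)
  have "{G \<in> space \<G>. \<forall>j\<in>L. s < col_norm d G j} \<subseteq> (\<Inter>j\<in>L. Y j -` A j \<inter> space \<G>)"
  proof
    fix G assume G: "G \<in> {G \<in> space \<G>. \<forall>j\<in>L. s < col_norm d G j}"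
    have "\<not> (\<forall>i<d. \<bar>G (i, j)\<bar> \<le> s / sqrt d)" if "j \<in> L" for j
    proof
      assume "\<forall>i<d. \<bar>G (i, j)\<bar> \<le> s / sqrt d"
      then have "col_norm d G j \<le> s" by (intro col_norm_le less_imp_le[OF s(1)]) blast
      moreover have "s < col_norm d G j" using G that by blast
      ultimately show False by linarith
    qed
    then show "G \<in> (\<Inter>j\<in>L. Y j -` A j \<inter> space \<G>)"
      unfolding Y_A using G by blast
  qed
  then have "measure \<G> {G \<in> space \<G>. \<forall>j\<in>L. s < col_norm d G j}
      \<le> measure \<G> (\<Inter>j\<in>L. Y j -` A j \<inter> space \<G>)"
    using ev by (rule G.finite_measure_mono)
  also have "\<dots> = (\<Prod>j\<in>L. measure \<G> (Y j -` A j \<inter> space \<G>))"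
    using finL L A_sets by (intro G.indep_varsD_finite[OF ind]) auto
  also have "\<dots> \<le> (\<Prod>j\<in>L. exp (- ((s / 3) ^ d)))"
  proof (rule prod_mono, intro conjI)
    fix j assume j: "j \<in> L"
    have "measure \<G> (Y j -` A j \<inter> space \<G>)
        = 1 - measure \<G> {G \<in> space \<G>. \<forall>i<d. \<bar>G (i, j)\<bar> \<le> s / sqrt d}"
      unfolding Y_A using meas[OF j] by (rule G.prob_compl)
    also have "\<dots> \<le> 1 - (s / 3) ^ d" using column_small_ge[OF s, of j] j L by auto
    also have "\<dots> \<le> exp (- ((s / 3) ^ d))"
      using exp_ge_add_one_self[of "- ((s / 3) ^ d)"] by simp
    finally show "measure \<G> (Y j -` A j \<inter> space \<G>) \<le> exp (- ((s / 3) ^ d))" .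
  qed auto
  also have "\<dots> = exp (- (card L * (s / 3) ^ d))"
    by (simp add: exp_of_nat_mult[symmetric])
  finally show ?thesis .
qed

text \<open>A sum of independent centered normal variables with nonzero coefficients is again normal
  with positive variance. It has a density and hence avoids 0 almost surely.\<close>

lemma AE_row_combination_nonzero:
  assumes i: "i < d" and J: "J \<subseteq> {..<m}" "J \<noteq> {}" and c: "\<And>j. j \<in> J \<Longrightarrow> c j \<noteq> 0"
  shows "AE G in \<G>. (\<Sum>j\<in>J. c j * G (i, j)) \<noteq> 0"
proof -
  have finJ: "finite J" using J finite_subset by blast
  \<comment> \<open>Grouping into singleton blocks reindexes the independent family from pairs to
    columns.\<close>
  have "G.indep_vars (\<lambda>j. PiM {(i, j)} (\<lambda>_. entry d)) (\<lambda>j G. restrict (\<lambda>ij. G ij) {(i, j)}) J"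
    using i J by (intro G.indep_vars_restrict[OF indep_entries]) (auto simp: disjoint_family_on_def)
  then have "G.indep_vars (\<lambda>_. borel) (\<lambda>j. (\<lambda>f. c j * f (i, j)) \<circ> (\<lambda>G. restrict (\<lambda>ij. G ij) {(i, j)})) J"
  proof (rule G.indep_vars_compose)
    fix j :: nat
    have [measurable]: "(\<lambda>f. f (i, j)) \<in> borel_measurable (PiM {(i, j)} (\<lambda>_. entry d))"
      using measurable_component_singleton[of "(i, j)" "{(i, j)}" "\<lambda>_. entry d"] by simp
    show "(\<lambda>f. c j * f (i, j)) \<in> borel_measurable (PiM {(i, j)} (\<lambda>_. entry d))"
      by (rule borel_measurable_times) simp_all
  qed
  then have ind: "G.indep_vars (\<lambda>_. borel) (\<lambda>j G. c j * G (i, j)) J"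
    by (simp add: o_def)
  have "distributed \<G> lborel (\<lambda>G. 0 + c j * G (i, j)) (normal_density (0 + c j * 0) (\<bar>c j\<bar> * sqrt (1 / d)))"
    if "j \<in> J" for j
    using i J c d that by (intro G.normal_density_affine[OF distributed_entry]) auto
  then have "distributed \<G> lborel (\<lambda>G. \<Sum>j\<in>J. c j * G (i, j))
      (normal_density (\<Sum>j\<in>J. 0) (sqrt (\<Sum>j\<in>J. (\<bar>c j\<bar> * sqrt (1 / d))\<^sup>2)))"
    using finJ J ind c d by (intro G.sum_indep_normal) auto
  then have "(AE G in \<G>. (\<Sum>j\<in>J. c j * G (i, j)) \<noteq> 0) \<longleftrightarrow>
      (AE x in lborel. 0 < ennreal (normal_density (\<Sum>j\<in>J. 0) (sqrt (\<Sum>j\<in>J. (\<bar>c j\<bar> * sqrt (1 / d))\<^sup>2)) x) \<longrightarrow> x \<noteq> 0)"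
    by (rule G.distributed_AE2) measurable
  moreover have "AE x in lborel. x \<noteq> (0::real)" by (rule AE_lborel_singleton)
  ultimately show ?thesis by (auto elim: eventually_mono)
qed

text \<open>The events shrink to the empty set because \<open>f\<close> is real-valued, so
  continuity from above applies and no moments have to be computed.\<close>

lemma exists_tail_bound:
  fixes f :: "_ \<Rightarrow> real"
  assumes f [measurable]: "f \<in> borel_measurable \<G>" and c: "0 < c"
  shows "\<exists>M\<ge>1. measure \<G> {G \<in> space \<G>. M < f G} \<le> (c :: real)"
proof -
  let ?A = "\<lambda>n. {G \<in> space \<G>. real n < f G}"
  have "(\<lambda>n. measure \<G> (?A n)) \<longlonglongrightarrow> measure \<G> (\<Inter>n. ?A n)"
    by (rule G.finite_Lim_measure_decseq) (auto simp: decseq_def)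
  moreover have "(\<Inter>n. ?A n) = {}"
  proof -
    have "\<exists>n. f G \<le> real n" for G by (rule real_arch_simple)
    then show ?thesis by (auto dest: leD)
  qed
  ultimately have "(\<lambda>n. measure \<G> (?A n)) \<longlonglongrightarrow> 0" by simp
  then have "eventually (\<lambda>n. measure \<G> (?A n) < c) sequentially"
    using c by (rule order_tendstoD)
  then have "eventually (\<lambda>n. measure \<G> (?A n) < c \<and> 1 \<le> n) sequentially"
    using eventually_ge_at_top by (rule eventually_conj)
  then obtain n where "measure \<G> (?A n) < c" "1 \<le> n"
    by (metis (mono_tags, lifting) eventually_happens' sequentially_bot)
  then show ?thesis by (intro exI[of _ "real n"]) auto
qed

end

section \<open>Measurability of the cost events\<close>

text \<open>
  Distinct data points may have the same image. Sums and cardinalities over an image are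
  therefore written as sums over the data set, weighted by the reciprocal fibre sizes.
\<close>

lemma sum_image_eq_weighted_sum:
  fixes f :: "'b \<Rightarrow> real"
  assumes "finite X"
  shows "sum f (h ` X) = (\<Sum>x\<in>X. f (h x) / card {x'\<in>X. h x' = h x})"
proof -
  have "(\<Sum>x\<in>X. f (h x) / card {x'\<in>X. h x' = h x})
      = (\<Sum>y\<in>h ` X. \<Sum>x\<in>{x\<in>X. h x = y}. f (h x) / card {x'\<in>X. h x' = h x})"
    by (rule sum.image_gen[OF assms])
  also have "\<dots> = (\<Sum>y\<in>h ` X. \<Sum>x\<in>{x\<in>X. h x = y}. f y / card {x'\<in>X. h x' = y})"
    by (intro sum.cong refl) auto
  also have "\<dots> = sum f (h ` X)"
  proof (rule sum.cong)
    fix y assume "y \<in> h ` X"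
    then have "card {x'\<in>X. h x' = y} \<noteq> 0" using assms by auto
    then show "(\<Sum>x\<in>{x\<in>X. h x = y}. f y / card {x'\<in>X. h x' = y}) = f y" by simp
  qed simp
  finally show ?thesis ..
qed

lemma borel_measurable_sum_image:
  fixes F :: "'a \<Rightarrow> 'b \<Rightarrow> real"
  assumes X: "finite X"
    and eq: "\<And>x y. x \<in> X \<Longrightarrow> y \<in> X \<Longrightarrow> {\<omega> \<in> space M. h \<omega> x = h \<omega> y} \<in> sets M"
    and F: "\<And>x. x \<in> X \<Longrightarrow> (\<lambda>\<omega>. F \<omega> (h \<omega> x)) \<in> borel_measurable M"
  shows "(\<lambda>\<omega>. \<Sum>y\<in>h \<omega> ` X. F \<omega> y) \<in> borel_measurable M"
proof -
  have card: "real (card {x'\<in>X. h \<omega> x' = h \<omega> x}) = (\<Sum>x'\<in>X. if h \<omega> x' = h \<omega> x then 1 else 0)" for \<omega> x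
    using X by (simp add: sum.inter_filter[symmetric])
  have "(\<lambda>\<omega>. \<Sum>x\<in>X. F \<omega> (h \<omega> x) / (\<Sum>x'\<in>X. if h \<omega> x' = h \<omega> x then 1 else 0)) \<in> borel_measurable M"
    by (intro borel_measurable_sum borel_measurable_divide F measurable_If eq) auto
  moreover have "sum (F \<omega>) (h \<omega> ` X) = (\<Sum>x\<in>X. F \<omega> (h \<omega> x) / (\<Sum>x'\<in>X. if h \<omega> x' = h \<omega> x then 1 else 0))" for \<omega>
    by (rule sum_image_eq_weighted_sum[OF X, of "F \<omega>" "h \<omega>", unfolded card])
  ultimately show ?thesis by (simp only:)
qed

context gaussian
begin

lemma measurable_dist_image:
  "(\<lambda>G. eucl_dist d (mat_apply d m G x) (mat_apply d m G y)) \<in> borel_measurable \<G>"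
proof -
  have "(\<lambda>G. sqrt (\<Sum>i<d. ((\<Sum>j<m. G (i, j) * x j) - (\<Sum>j<m. G (i, j) * y j))\<^sup>2)) \<in> borel_measurable \<G>"
    by (intro measurable_compose[OF _ borel_measurable_sqrt] borel_measurable_sum borel_measurable_power borel_measurable_diff
        borel_measurable_times borel_measurable_const measurable_entry) auto
  moreover have "eucl_dist d (mat_apply d m G x) (mat_apply d m G y)
      = sqrt (\<Sum>i<d. ((\<Sum>j<m. G (i, j) * x j) - (\<Sum>j<m. G (i, j) * y j))\<^sup>2)" for G
    unfolding eucl_dist_def L2_set_def mat_apply_def by (intro arg_cong[of _ _ sqrt] sum.cong) auto
  ultimately show ?thesis by (simp only:)
qed

text \<open>Images vanish beyond the first \<open>d\<close> coordinates, so their equality is the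
  vanishing of a measurable distance.\<close>

lemma sets_image_eq: "{G \<in> space \<G>. mat_apply d m G x = mat_apply d m G y} \<in> sets \<G>"
proof -
  have eq: "mat_apply d m G x = mat_apply d m G y \<longleftrightarrow> eucl_dist d (mat_apply d m G x) (mat_apply d m G y) = 0" for G
    by (auto simp: eucl_dist_def L2_set_eq_0_iff mat_apply_def fun_eq_iff)
  show ?thesis
    unfolding eq by (rule borel_measurable_eq[OF measurable_dist_image borel_measurable_const])
qed

lemma sets_card_image:
  assumes "finite I"
  shows "{G \<in> space \<G>. card (mat_apply d m G ` I) = k} \<in> sets \<G>"
proof -
  have "(\<lambda>G. \<Sum>y\<in>mat_apply d m G ` I. 1 :: real) \<in> borel_measurable \<G>"
    by (rule borel_measurable_sum_image[OF assms sets_image_eq]) simp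
  then have "{G \<in> space \<G>. (\<Sum>y\<in>mat_apply d m G ` I. 1 :: real) = real k} \<in> sets \<G>"
    by (rule borel_measurable_eq) (rule borel_measurable_const)
  then show ?thesis by simp
qed

lemma measurable_gcost_image:
  assumes X: "finite X" "I \<subseteq> X" and [measurable]: "\<phi> \<in> borel_measurable borel"
  shows "(\<lambda>G. gcost \<phi> d (mat_apply d m G ` X) (mat_apply d m G ` I)) \<in> borel_measurable \<G>"
  unfolding gcost_def
proof (rule borel_measurable_sum_image[where h = "mat_apply d m", OF X(1) sets_image_eq])
  fix x
  have "(\<lambda>G. Min ((\<lambda>i. \<phi> (eucl_dist d (mat_apply d m G x) (mat_apply d m G i))) ` I)) \<in> borel_measurable \<G>"
    by (rule borel_measurable_Min[OF finite_subset[OF X(2,1)]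
          measurable_compose[OF measurable_dist_image assms(3)]])
  then show "(\<lambda>G. Min ((\<lambda>s. \<phi> (eucl_dist d (mat_apply d m G x) s)) ` mat_apply d m G ` I)) \<in> borel_measurable \<G>"
    by (simp only: image_image)
qed

text \<open>Every candidate set of centers is the image of some member of the fixed finite family
  \<open>Pow X\<close>, so the minimum over a random family becomes a finite combination of
  measurable conditions.\<close>

lemma sets_opt_cost_image_le:
  assumes X: "finite X" and \<phi>: "\<phi> \<in> borel_measurable borel"
  shows "{G \<in> space \<G>. opt_cost (gcost \<phi> d (mat_apply d m G ` X)) k (mat_apply d m G ` X) \<le> c} \<in> sets \<G>"
proof -
  let ?C = "\<lambda>G I. gcost \<phi> d (mat_apply d m G ` X) (mat_apply d m G ` I)"
  let ?K = "\<lambda>G I. card (mat_apply d m G ` I) = k"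
  have subsets: "{S. S \<subseteq> mat_apply d m G ` X \<and> card S = k} = (\<lambda>I. mat_apply d m G ` I) ` {I \<in> Pow X. ?K G I}" for G
    by (intro equalityI subsetI; elim CollectE conjE imageE; (elim subset_imageE)?) auto
  \<comment> \<open>If no subset has an image of size \<open>k\<close>, the optimum is the constant
    \<open>Min {}\<close>; this case is kept apart.\<close>
  have eq: "opt_cost (gcost \<phi> d (mat_apply d m G ` X)) k (mat_apply d m G ` X) \<le> c \<longleftrightarrow>
      (\<exists>I\<in>Pow X. ?K G I \<and> ?C G I \<le> c) \<or> (\<not> (\<exists>I\<in>Pow X. ?K G I) \<and> Min {} \<le> c)" for G
  proof -
    let ?A = "{I \<in> Pow X. ?K G I}"
    have "opt_cost (gcost \<phi> d (mat_apply d m G ` X)) k (mat_apply d m G ` X) = Min (?C G ` ?A)"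
      by (simp only: opt_cost_def subsets image_image)
    moreover have "finite ?A" using X by simp
    moreover have "Min (?C G ` ?A) \<le> c \<longleftrightarrow> (\<exists>I\<in>?A. ?C G I \<le> c)" if "?A \<noteq> {}"
      using that \<open>finite ?A\<close> by (subst Min_le_iff) auto
    ultimately show ?thesis by (cases "?A = {}") (simp_all only: image_empty, blast+)
  qed
  show ?thesis
    unfolding eq
    by (intro sets.sets_Collect_disj sets.sets_Collect_conj sets.sets_Collect_neg
        sets.sets_Collect_finite_Ex sets.sets_Collect_const sets_card_image
        borel_measurable_le borel_measurable_const measurable_gcost_image X \<phi> finite_Pow_iff[THEN iffD2])
       (auto intro: finite_subset[OF _ X])
qed

text \<open>The pull-back takes values in the finite set \<open>Pow X\<close>, so \<open>P\<close>
  may be arbitrary: for each fixed \<open>W\<close>, the event that the pull-back equals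
  \<open>W\<close> is described by equalities of images.\<close>

lemma sets_opt_centers_image_imp:
  assumes X: "finite X" and \<phi>: "\<phi> \<in> borel_measurable borel"
  shows "{G \<in> space \<G>. \<forall>T. is_opt_centers (gcost \<phi> d (mat_apply d m G ` X)) k (mat_apply d m G ` X) T
    \<longrightarrow> P {x \<in> X. mat_apply d m G x \<in> T}} \<in> sets \<G>"
proof -
  let ?C = "\<lambda>G I. gcost \<phi> d (mat_apply d m G ` X) (mat_apply d m G ` I)"
  let ?K = "\<lambda>G I. card (mat_apply d m G ` I) = k"
  let ?W = "\<lambda>G I W. \<forall>x\<in>X. ((\<exists>i\<in>I. mat_apply d m G x = mat_apply d m G i) \<longrightarrow> x \<in> W) \<and>
      (x \<in> W \<longrightarrow> (\<exists>i\<in>I. mat_apply d m G x = mat_apply d m G i))"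
  have opt: "is_opt_centers (gcost \<phi> d (mat_apply d m G ` X)) k (mat_apply d m G ` X) T \<longleftrightarrow>
      (\<exists>I\<in>Pow X. T = mat_apply d m G ` I \<and> ?K G I \<and> (\<forall>J\<in>Pow X. ?K G J \<longrightarrow> ?C G I \<le> ?C G J))" for G T
  proof -
    have "(\<forall>S. S \<subseteq> mat_apply d m G ` X \<and> card S = k \<longrightarrow> c \<le> gcost \<phi> d (mat_apply d m G ` X) S)
        \<longleftrightarrow> (\<forall>J\<in>Pow X. ?K G J \<longrightarrow> c \<le> ?C G J)" for c
      using all_subset_image[of "mat_apply d m G" X
          "\<lambda>S. card S = k \<longrightarrow> c \<le> gcost \<phi> d (mat_apply d m G ` X) S"] by blast
    moreover have "T \<subseteq> mat_apply d m G ` X \<longleftrightarrow> (\<exists>I\<in>Pow X. T = mat_apply d m G ` I)"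
      by (simp only: subset_image_iff Bex_def Pow_iff)
    ultimately show ?thesis
      unfolding is_opt_centers_def is_arg_min_linorder by metis
  qed
  have pull: "P {x \<in> X. mat_apply d m G x \<in> mat_apply d m G ` I} \<longleftrightarrow> (\<forall>W\<in>Pow X. ?W G I W \<longrightarrow> P W)" for G I
  proof -
    have "?W G I W \<longleftrightarrow> W = {x \<in> X. mat_apply d m G x \<in> mat_apply d m G ` I}" if "W \<in> Pow X" for W
      using that by (auto simp: image_iff)
    then show ?thesis by auto
  qed
  have "(\<forall>T. is_opt_centers (gcost \<phi> d (mat_apply d m G ` X)) k (mat_apply d m G ` X) T
      \<longrightarrow> P {x \<in> X. mat_apply d m G x \<in> T}) \<longleftrightarrow>
      (\<forall>I\<in>Pow X. ?K G I \<and> (\<forall>J\<in>Pow X. ?K G J \<longrightarrow> ?C G I \<le> ?C G J) \<longrightarrow> (\<forall>W\<in>Pow X. ?W G I W \<longrightarrow> P W))" for G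
    unfolding opt pull[symmetric] by blast
  moreover have "{G \<in> space \<G>. \<forall>I\<in>Pow X. ?K G I \<and> (\<forall>J\<in>Pow X. ?K G J \<longrightarrow> ?C G I \<le> ?C G J)
      \<longrightarrow> (\<forall>W\<in>Pow X. ?W G I W \<longrightarrow> P W)} \<in> sets \<G>"
    by (intro sets.sets_Collect_finite_All sets.sets_Collect_imp sets.sets_Collect_conj
        sets.sets_Collect_finite_Ex sets.sets_Collect_const sets_card_image
        sets_image_eq borel_measurable_le measurable_gcost_image X \<phi> finite_Pow_iff[THEN iffD2])
       (auto intro: finite_subset[OF _ X])
  ultimately show ?thesis by (simp only:)
qed

end

section \<open>The good event\<close>

lemma mat_apply_stair_diff:
  assumes "r < d" "a \<le> b" "b \<le> m"
  shows "mat_apply d m G (stair w b) r - mat_apply d m G (stair w a) r = (\<Sum>j=a..<b. w j * G (r, j))"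
proof -
  have "mat_apply d m G (stair w b) r - mat_apply d m G (stair w a) r
      = (\<Sum>j<m. G (r, j) * (stair w b j - stair w a j))"
    using assms by (simp add: mat_apply_def sum_subtractf right_diff_distrib)
  also have "\<dots> = (\<Sum>j=a..<b. G (r, j) * (stair w b j - stair w a j))"
    using assms by (intro sum.mono_neutral_right) (auto simp: stair_def)
  also have "\<dots> = (\<Sum>j=a..<b. w j * G (r, j))"
    by (intro sum.cong) (auto simp: stair_def)
  finally show ?thesis .
qed

lemma eucl_dist_mat_apply_stair_Suc:
  assumes "i < m" "0 \<le> w i"
  shows "eucl_dist d (mat_apply d m G (stair w i)) (mat_apply d m G (stair w (Suc i))) = w i * col_norm d G i"
proof -
  have "eucl_dist d (mat_apply d m G (stair w (Suc i))) (mat_apply d m G (stair w i))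
      = L2_set (\<lambda>r. w i * G (r, i)) {..<d}"
    unfolding eucl_dist_def
    using assms mat_apply_stair_diff[of _ d i "Suc i" m G w] by (intro L2_set_cong) auto
  then show ?thesis
    using assms by (simp add: L2_set_right_distrib col_norm_def eucl_dist_commute)
qed

text \<open>Row 0 alone separates two points: the difference of their images there is a combination
  of Gaussian entries with nonzero coefficients.\<close>

lemma (in gaussian) AE_inj_on_mat_apply_stair:
  assumes w: "\<And>i. i < m \<Longrightarrow> w i \<noteq> 0"
  shows "AE G in \<G>. inj_on (\<lambda>j. mat_apply d m G (stair w j)) {..m}"
proof -
  have "AE G in \<G>. mat_apply d m G (stair w a) \<noteq> mat_apply d m G (stair w b)"
    if ab: "a < b" "b \<le> m" for a b
  proof -
    have "AE G in \<G>. (\<Sum>j=a..<b. w j * G (0, j)) \<noteq> 0"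
      using ab d w by (intro AE_row_combination_nonzero) auto
    then show ?thesis
    proof (rule eventually_mono)
      fix G :: "nat \<times> nat \<Rightarrow> real" assume "(\<Sum>j=a..<b. w j * G (0, j)) \<noteq> 0"
      then have "mat_apply d m G (stair w b) 0 - mat_apply d m G (stair w a) 0 \<noteq> 0"
        using mat_apply_stair_diff[of 0 d a b m G w] ab d by simp
      then show "mat_apply d m G (stair w a) \<noteq> mat_apply d m G (stair w b)" by auto
    qed
  qed
  then have "AE G in \<G>. \<forall>a\<in>{..m}. \<forall>b\<in>{..m}. a < b \<longrightarrow>
      mat_apply d m G (stair w a) \<noteq> mat_apply d m G (stair w b)"
    by (intro AE_finite_allI finite_atMost) auto
  then show ?thesis
    by (rule eventually_mono) (intro linorder_inj_onI, auto)
qed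

text \<open>A union bound over four bad events, with \<open>m = n\<close>. There is no circularity
  in the parameters: \<open>M\<close> depends only on the law of the matrix, and \<open>R\<close>
  and \<open>\<eta>\<close> are chosen after it.\<close>

lemma (in cost_profile) exists_bad_dataset:
  assumes k: "3 \<le> k" "k < n" and d: "1 \<le> d" and u: "0 < u" "u \<le> 1 / 30"
    and many: "3 \<le> real (k - 2) * (u ^ 4 / 3) ^ d"
  shows "\<exists>m X. X \<subseteq> topspace (Euclidean_space m) \<and> finite X \<and> card X = n \<and> doubling_dim m X \<le> 4 \<and>
    measure (gaussian_matrix d m) {G \<in> space (gaussian_matrix d m).
      opt_cost (gcost \<phi> d (mat_apply d m G ` X)) k (mat_apply d m G ` X)
        \<le> u\<^sup>2 * opt_cost (gcost \<phi> m X) k X} \<ge> 2 / 3 \<and>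
    measure (gaussian_matrix d m) {G \<in> space (gaussian_matrix d m).
      \<forall>T. is_opt_centers (gcost \<phi> d (mat_apply d m G ` X)) k (mat_apply d m G ` X) T \<longrightarrow>
        gcost \<phi> m X {x \<in> X. mat_apply d m G x \<in> T} \<ge> 1 / (2 * u) * opt_cost (gcost \<phi> m X) k X} \<ge> 2 / 3"
proof -
  interpret gaussian d n by (rule gaussian.intro[OF d])
  define \<theta> :: real where "\<theta> = 1 / 100"
  have "(\<lambda>G. \<Sum>i<n. col_norm d G i) \<in> borel_measurable \<G>"
    by (intro borel_measurable_sum measurable_col_norm) auto
  from exists_tail_bound[OF this, of "1 / 50"] obtain M
    where M: "1 \<le> M" "measure \<G> {G \<in> space \<G>. M < (\<Sum>i<n. col_norm d G i)} \<le> 1 / 50"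
    by (auto simp only: zero_less_divide_1_iff zero_less_numeral simp_thms)
  define R where "R = (M / u + 1) / \<theta>"
  define \<eta> where "\<eta> = u\<^sup>2 / (2 * (real n)\<^sup>2 * M)"
  have \<eta>: "0 < \<eta>" "(real n)\<^sup>2 * \<eta> * M = u\<^sup>2 / 2"
    using k u M by (auto simp: \<eta>_def)
  have "(real n)\<^sup>2 * \<eta> * 1 \<le> (real n)\<^sup>2 * \<eta> * M" using M \<eta>(1) by (intro mult_left_mono) auto
  then have \<eta>': "(real n)\<^sup>2 * \<eta> \<le> u\<^sup>2 / 2" using \<eta> by simp
  have R\<theta>: "M / u + 1 = R * \<theta>" by (simp add: R_def \<theta>_def)
  have "1 / u \<le> M / u" using M u by (simp add: divide_right_mono)
  also have "\<dots> \<le> R"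
  proof -
    have "y \<le> (y + 1) / \<theta>" if "0 \<le> y" for y using that by (simp add: \<theta>_def)
    then show ?thesis using M u by (simp add: R_def)
  qed
  finally have R: "1 / u \<le> R" .
  interpret C: chain \<phi> n k u R \<eta>
    using k u R \<eta> \<eta>' by unfold_locales auto
  let ?h = "mat_apply d n"
  let ?X = "C.X"
  \<comment> \<open>In order: edge 0 collapses, edge 1 shrinks too much, the total stretch is too
    large, no expensive edge is contracted enough.\<close>
  define B0 where "B0 = {G \<in> space \<G>. col_norm d G 0 \<le> u}"
  define B1 where "B1 = {G \<in> space \<G>. col_norm d G 1 \<le> \<theta>}"
  define B2 where "B2 = {G \<in> space \<G>. M < (\<Sum>i<n. col_norm d G i)}"
  define B3 where "B3 = {G \<in> space \<G>. \<forall>j\<in>{2..<k}. u ^ 4 < col_norm d G j}"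
  have meas: "B0 \<in> sets \<G>" "B1 \<in> sets \<G>" "B2 \<in> sets \<G>" "B3 \<in> sets \<G>"
    unfolding B0_def B1_def B2_def B3_def using k
    by (intro sets.sets_Collect_finite_All borel_measurable_le borel_measurable_less
        borel_measurable_sum measurable_col_norm borel_measurable_const; simp)+
  have "measure \<G> B0 \<le> 1 / 10"
    using col_norm_small_le[of 0 u] k u by (simp add: B0_def)
  moreover have "measure \<G> B1 \<le> 3 / 100"
    using col_norm_small_le[of 1 \<theta>] k by (simp add: B1_def \<theta>_def)
  moreover have "measure \<G> B2 \<le> 1 / 50"
    using M by (simp add: B2_def)
  moreover have "measure \<G> B3 \<le> 2 / 17"
  proof -
    have "measure \<G> B3 \<le> exp (- (card {2..<k} * (u ^ 4 / 3) ^ d))"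
      unfolding B3_def using k u by (intro no_col_norm_small_le) (auto intro: power_le_one)
    also have "\<dots> \<le> exp (- 3)"
      using many by (simp only: exp_le_cancel_iff neg_le_iff_le card_atLeastLessThan)
    \<comment> \<open>By \<open>exp 3 \<ge> 1 + 3 + 9 / 2 = 17 / 2\<close>.\<close>
    also have "\<dots> \<le> 2 / 17"
      using exp_lower_Taylor_quadratic[of 3] by (simp add: exp_minus field_simps)
    finally show ?thesis .
  qed
  moreover have "measure \<G> (B0 \<union> B1 \<union> B2 \<union> B3) \<le> measure \<G> B0 + measure \<G> B1 + measure \<G> B2 + measure \<G> B3"
    using measure_Un_le[of B0 \<G> B1] measure_Un_le[of "B0 \<union> B1" \<G> B2]
      measure_Un_le[of "B0 \<union> B1 \<union> B2" \<G> B3] meas by simp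
  ultimately have "measure \<G> (B0 \<union> B1 \<union> B2 \<union> B3) \<le> 1 / 3" by linarith
  then have good_prob: "2 / 3 \<le> measure \<G> (space \<G> - (B0 \<union> B1 \<union> B2 \<union> B3))"
    using meas by (subst G.prob_compl) auto
  have inj: "AE G in \<G>. inj_on (\<lambda>j. ?h G (C.p j)) {..n}"
    using C.w_pos by (intro AE_inj_on_mat_apply_stair) (simp add: less_imp_neq[symmetric])
  have good: "\<exists>e. projected_chain \<phi> n k u R \<eta> d (\<lambda>j. ?h G (C.p j)) (col_norm d G) M \<theta> e"
    if G: "G \<in> space \<G> - (B0 \<union> B1 \<union> B2 \<union> B3)" and "inj_on (\<lambda>j. ?h G (C.p j)) {..n}" for G
  proof -
    obtain e where e: "2 \<le> e" "e < k" "col_norm d G e \<le> u ^ 4"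
      using G by (auto simp: B3_def not_less)
    have "eucl_dist d (?h G (C.p i)) (?h G (C.p (Suc i))) = C.w i * col_norm d G i" if "Suc i < n" for i
      using that less_imp_le[OF C.w_pos] by (intro eucl_dist_mat_apply_stair_Suc) auto
    moreover have "inj_on (\<lambda>j. ?h G (C.p j)) {..<n}" using that(2) by (rule inj_on_subset) auto
    ultimately have "projected_chain \<phi> n k u R \<eta> d (\<lambda>j. ?h G (C.p j)) (col_norm d G) M \<theta> e"
      using G M(1) e R\<theta> \<eta>(2)
      by unfold_locales (auto simp: B0_def B1_def B2_def \<theta>_def col_norm_def)
    then show ?thesis ..
  qed
  have event: "2 / 3 \<le> measure \<G> {G \<in> space \<G>. P G}"
    if P: "{G \<in> space \<G>. P G} \<in> sets \<G>"
      and imp: "\<And>G e. projected_chain \<phi> n k u R \<eta> d (\<lambda>j. ?h G (C.p j)) (col_norm d G) M \<theta> e \<Longrightarrow> P G" for P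
  proof -
    \<comment> \<open>Injectivity holds only almost surely, so the inclusion of events holds up to a
      null set and the target event has to be measurable.\<close>
    have "AE G in \<G>. G \<in> space \<G> - (B0 \<union> B1 \<union> B2 \<union> B3) \<longrightarrow> G \<in> {G \<in> space \<G>. P G}"
      using inj by (rule eventually_mono) (use good imp in blast)
    then have "measure \<G> (space \<G> - (B0 \<union> B1 \<union> B2 \<union> B3)) \<le> measure \<G> {G \<in> space \<G>. P G}"
      using P by (rule G.finite_measure_mono_AE)
    then show ?thesis using good_prob by linarith
  qed
  have image: "?h G ` ?X = (\<lambda>j. ?h G (C.p j)) ` {..<n}" for G by (rule image_image)
  show ?thesis
  proof (intro exI[of _ n] exI[of _ ?X] conjI)
    show "?X \<subseteq> topspace (Euclidean_space n)"
      by (auto simp: topspace_Euclidean_space stair_def)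
    show "finite ?X" by simp
    show "card ?X = n" by (rule C.card_X)
    show "doubling_dim n ?X \<le> 4" using C.w_pos k by (intro doubling_dim_stair) auto
    show "2 / 3 \<le> measure \<G> {G \<in> space \<G>. opt_cost (gcost \<phi> d (?h G ` ?X)) k (?h G ` ?X)
        \<le> u\<^sup>2 * opt_cost (gcost \<phi> n ?X) k ?X}"
    proof (rule event)
      show "{G \<in> space \<G>. opt_cost (gcost \<phi> d (?h G ` ?X)) k (?h G ` ?X)
          \<le> u\<^sup>2 * opt_cost (gcost \<phi> n ?X) k ?X} \<in> sets \<G>"
        by (rule sets_opt_cost_image_le) (simp, rule measurable_profile)
      fix G e assume "projected_chain \<phi> n k u R \<eta> d (\<lambda>j. ?h G (C.p j)) (col_norm d G) M \<theta> e"
      then interpret projected_chain \<phi> n k u R \<eta> d "\<lambda>j. ?h G (C.p j)" "col_norm d G" M \<theta> e .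
      show "opt_cost (gcost \<phi> d (?h G ` ?X)) k (?h G ` ?X) \<le> u\<^sup>2 * opt_cost (gcost \<phi> n ?X) k ?X"
        unfolding image by (rule opt_cost_Q_le)
    qed
    show "2 / 3 \<le> measure \<G> {G \<in> space \<G>.
        \<forall>T. is_opt_centers (gcost \<phi> d (?h G ` ?X)) k (?h G ` ?X) T \<longrightarrow>
          gcost \<phi> n ?X {x \<in> ?X. ?h G x \<in> T} \<ge> 1 / (2 * u) * opt_cost (gcost \<phi> n ?X) k ?X}"
    proof (rule event)
      show "{G \<in> space \<G>. \<forall>T. is_opt_centers (gcost \<phi> d (?h G ` ?X)) k (?h G ` ?X) T \<longrightarrow>
          gcost \<phi> n ?X {x \<in> ?X. ?h G x \<in> T} \<ge> 1 / (2 * u) * opt_cost (gcost \<phi> n ?X) k ?X} \<in> sets \<G>"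
        by (rule sets_opt_centers_image_imp[where P = "\<lambda>S. _ \<le> gcost \<phi> n ?X S"])
          (simp, rule measurable_profile)
      fix G e assume "projected_chain \<phi> n k u R \<eta> d (\<lambda>j. ?h G (C.p j)) (col_norm d G) M \<theta> e"
      then interpret projected_chain \<phi> n k u R \<eta> d "\<lambda>j. ?h G (C.p j)" "col_norm d G" M \<theta> e .
      show "\<forall>T. is_opt_centers (gcost \<phi> d (?h G ` ?X)) k (?h G ` ?X) T \<longrightarrow>
          gcost \<phi> n ?X {x \<in> ?X. ?h G x \<in> T} \<ge> 1 / (2 * u) * opt_cost (gcost \<phi> n ?X) k ?X"
        unfolding image by (intro allI impI pull_back_expensive) auto
    qed
  qed
qed

section \<open>Asymptotics\<close>

text \<open>With \<open>u\<^sup>4 = 3 k powr (- 1 / (2 d))\<close>, an edge is contracted by a factor \<open>u\<^sup>4\<close> with probability at least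
  \<open>1 / sqrt k\<close>.\<close>

lemma (in cost_profile) asymptotic_bad_datasets:
  fixes k d :: "nat \<Rightarrow> nat"
  assumes k: "\<And>n. 2 \<le> n \<Longrightarrow> k n < n" "filterlim k at_top sequentially"
    and d: "\<And>n. 2 \<le> n \<Longrightarrow> 1 \<le> d n" "(\<lambda>n. real (d n)) \<in> o(\<lambda>n. ln (real (k n)))"
  shows "\<exists>\<delta> K :: nat \<Rightarrow> real. \<delta> \<longlonglongrightarrow> 0 \<and> filterlim K at_top sequentially \<and>
    (\<forall>\<^sub>F n in sequentially. \<exists>m X. X \<subseteq> topspace (Euclidean_space m) \<and>
      finite X \<and> card X = n \<and> doubling_dim m X \<le> 4 \<and>
      measure (gaussian_matrix (d n) m) {G \<in> space (gaussian_matrix (d n) m).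
        opt_cost (gcost \<phi> (d n) (mat_apply (d n) m G ` X)) (k n) (mat_apply (d n) m G ` X)
          \<le> \<delta> n * opt_cost (gcost \<phi> m X) (k n) X} \<ge> 2 / 3 \<and>
      measure (gaussian_matrix (d n) m) {G \<in> space (gaussian_matrix (d n) m).
        \<forall>T. is_opt_centers (gcost \<phi> (d n) (mat_apply (d n) m G ` X)) (k n) (mat_apply (d n) m G ` X) T \<longrightarrow>
          gcost \<phi> m X {x \<in> X. mat_apply (d n) m G x \<in> T}
            \<ge> K n * opt_cost (gcost \<phi> m X) (k n) X} \<ge> 2 / 3)"
    (is "\<exists>\<delta> K. _ \<and> _ \<and> (\<forall>\<^sub>F n in sequentially. ?P \<delta> K n)")
proof -
  define u where "u n = root 4 (3 * exp (- (ln (k n) / (2 * d n))))" for n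
  have u_pos: "0 < u n" for n by (simp add: u_def)
  have u_4: "u n ^ 4 = 3 * exp (- (ln (k n) / (2 * d n)))" for n
    by (simp add: u_def)
  have "filterlim (\<lambda>n. ln (real (k n)) / real (d n)) at_top sequentially"
  proof -
    have ev_d: "\<forall>\<^sub>F n in sequentially. 1 \<le> d n"
      using eventually_ge_at_top[of 2] by (rule eventually_mono) (rule d(1))
    have ev_k: "\<forall>\<^sub>F n in sequentially. 2 \<le> k n"
      using k(2) by (simp add: filterlim_at_top)
    have "(\<lambda>n. real (d n) / ln (real (k n))) \<longlonglongrightarrow> 0"
      using d(2) by (rule smalloD_tendsto)
    \<comment> \<open>Eventual positivity makes the inverse of this null sequence tend to plus
      infinity.\<close>
    moreover have "\<forall>\<^sub>F n in sequentially. 0 < real (d n) / ln (real (k n))"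
      using ev_d ev_k by eventually_elim auto
    ultimately have "filterlim (\<lambda>n. inverse (real (d n) / ln (real (k n)))) at_top sequentially"
      by (rule filterlim_inverse_at_top)
    then show ?thesis by simp
  qed
  then have "filterlim (\<lambda>n. 1 / 2 * (ln (real (k n)) / real (d n))) at_top sequentially"
    by (intro filterlim_tendsto_pos_mult_at_top[OF tendsto_const]) auto
  then have "filterlim (\<lambda>n. - (1 / 2 * (ln (real (k n)) / real (d n)))) at_bot sequentially"
    by (simp add: filterlim_uminus_at_bot)
  then have "(\<lambda>n. exp (- (1 / 2 * (ln (real (k n)) / real (d n))))) \<longlonglongrightarrow> 0"
    by (rule filterlim_compose[OF exp_at_bot])
  then have "(\<lambda>n. root 4 (3 * exp (- (1 / 2 * (ln (real (k n)) / real (d n)))))) \<longlonglongrightarrow> root 4 (3 * 0)"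
    by (intro tendsto_real_root tendsto_mult tendsto_const)
  then have u_0: "u \<longlonglongrightarrow> 0" by (simp add: u_def[abs_def])
  have u_sq: "(\<lambda>n. (u n)\<^sup>2) \<longlonglongrightarrow> 0" using tendsto_power[OF u_0, of 2] by simp
  have u_inv: "filterlim (\<lambda>n. 1 / (2 * u n)) at_top sequentially"
  proof -
    have "(\<lambda>n. 2 * u n) \<longlonglongrightarrow> 0" using tendsto_mult[OF tendsto_const u_0, of 2] by simp
    then have "filterlim (\<lambda>n. inverse (2 * u n)) at_top sequentially"
      using u_pos by (intro filterlim_inverse_at_top) auto
    then show ?thesis by (simp add: inverse_eq_divide)
  qed
  have many: "3 \<le> real (k n - 2) * (u n ^ 4 / 3) ^ d n" if "16 \<le> k n" "2 \<le> n" for n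
  proof -
    have "(u n ^ 4 / 3) ^ d n = exp (- (ln (k n) / 2))"
      using d(1)[OF that(2)] by (simp add: u_4 exp_of_nat_mult[symmetric])
    also have "\<dots> = 1 / sqrt (k n)"
      using that by (simp add: exp_minus ln_sqrt[symmetric] inverse_eq_divide)
    finally have eq: "(u n ^ 4 / 3) ^ d n = 1 / sqrt (k n)" .
    \<comment> \<open>From \<open>sqrt (k n) \<ge> 4\<close> follows
      \<open>k n \<ge> 4 * sqrt (k n)\<close>; the spare \<open>sqrt (k n)\<close> absorbs the 2
      lost by excluding edges 0 and 1.\<close>
    have "sqrt 16 \<le> sqrt (k n)" using that by (intro real_sqrt_le_mono) simp
    then have "4 \<le> sqrt (k n)" by simp
    then have "4 * sqrt (k n) \<le> sqrt (k n) * sqrt (k n)" by (intro mult_right_mono) auto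
    then have "3 * sqrt (k n) \<le> real (k n - 2)"
      using that \<open>4 \<le> sqrt (k n)\<close> by (simp add: of_nat_diff)
    then show ?thesis unfolding eq using that by (simp add: field_simps)
  qed
  have "\<forall>\<^sub>F n in sequentially. u n < 1 / 30"
    using u_0 by (rule order_tendstoD) simp
  moreover have "\<forall>\<^sub>F n in sequentially. 16 \<le> k n"
    using k(2) by (simp add: filterlim_at_top)
  moreover have "\<forall>\<^sub>F n in sequentially. 2 \<le> n" by (rule eventually_ge_at_top)
  ultimately have "\<forall>\<^sub>F n in sequentially. 3 \<le> k n \<and> k n < n \<and> 1 \<le> d n \<and> u n \<le> 1 / 30 \<and>
      3 \<le> real (k n - 2) * (u n ^ 4 / 3) ^ d n"
  proof eventually_elim
    case (elim n)
    then show ?case using k(1) d(1) many[of n] by simp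
  qed
  then have "\<forall>\<^sub>F n in sequentially. ?P (\<lambda>n. (u n)\<^sup>2) (\<lambda>n. 1 / (2 * u n)) n"
  proof eventually_elim
    case (elim n)
    then show ?case using u_pos by (intro exists_bad_dataset) auto
  qed
  then show ?thesis
    using u_sq u_inv by (intro exI[of _ "\<lambda>n. (u n)\<^sup>2"] exI[of _ "\<lambda>n. 1 / (2 * u n)"] conjI)
qed

theorem theorem6p6:
  fixes cost :: "nat \<Rightarrow> (nat \<Rightarrow> real) set \<Rightarrow> (nat \<Rightarrow> real) set \<Rightarrow> real"
  assumes "cost \<in> {kmeans_cost, kmedians_cost}"
  shows "\<exists>D>0. \<forall>k d :: nat \<Rightarrow> nat.
    (\<forall>n\<ge>2. 0 < k n \<and> k n < n) \<and> filterlim k at_top sequentially \<and>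
    (\<forall>n\<ge>2. 1 \<le> d n) \<and> (\<lambda>n. real (d n)) \<in> o(\<lambda>n. ln (real (k n))) \<longrightarrow>
    (\<exists>\<delta> K :: nat \<Rightarrow> real. \<delta> \<longlonglongrightarrow> 0 \<and> filterlim K at_top sequentially \<and>
      (\<forall>\<^sub>F n in sequentially. \<exists>m X. X \<subseteq> topspace (Euclidean_space m) \<and>
        finite X \<and> card X = n \<and> doubling_dim m X \<le> D \<and>
        measure (gaussian_matrix (d n) m)
          {G \<in> space (gaussian_matrix (d n) m). 
             let GX = mat_apply (d n) m G ` X in
             opt_cost (cost (d n) GX) (k n) GX \<le> \<delta> n * opt_cost (cost m X) (k n) X} \<ge> 2 / 3 \<and>
        measure (gaussian_matrix (d n) m)
          {G \<in> space (gaussian_matrix (d n) m). 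
             let GX = mat_apply (d n) m G ` X in
             \<forall>T. is_opt_centers (cost (d n) GX) (k n) GX T \<longrightarrow>
               cost m X {x \<in> X. mat_apply (d n) m G x \<in> T} \<ge> K n * opt_cost (cost m X) (k n) X} \<ge> 2 / 3))"
proof -
  obtain \<phi> where \<phi>: "cost_profile \<phi>" "cost = gcost \<phi>"
  proof -
    have "kmeans_cost = gcost (\<lambda>t. t\<^sup>2)" "kmedians_cost = gcost (\<lambda>t. t)"
      by (simp_all add: fun_eq_iff kmeans_cost_def kmedians_cost_def gcost_def)
    then show ?thesis
      using assms that cost_profile_square cost_profile_ident by auto
  qed
  show ?thesis
    unfolding \<phi>(2) Let_def
    using cost_profile.asymptotic_bad_datasets[OF \<phi>(1)] by (intro exI[of _ 4] conjI allI impI) auto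
qed

end
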